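(* Assume that $n\geq2$. Then for any place $\nu$ of $\mathbb{Q}$ and for any $Q_0\in V(\mathbb{Q})$, we have $$\alpha_{\mathrm{ess}}^{\nu}(Q_0)=2.$$
   Context: Let $F\in\mathbb{Z}[x_0,\ldots,x_n]$ be an integral non-degenerate quadratic form and $V\subset\mathbb{P}^n$ the projective quadric $F=0$ over $\mathbb{Q}$, assumed to satisfy $V(\mathbb{Q})\neq\varnothing$. Let $H:\mathbb{P}^n(\mathbb{Q})\to\mathbb{R}_{>0}$ be the naive height: $H([x_0:\cdots:x_n])=\max_i|x_i|$ for coprime integers $x_0,\ldots,x_n$. For a place $\nu$ of $\mathbb{Q}$ (real, with $\mathbb{Q}_\nu=\mathbb{R}$, or $p$-adic), let $d_\nu$ be a projective distance function on $\mathbb{P}^n(\mathbb{Q}_\nu)$, e.g. $d_\nu([x],[y])=\max_{i<j}|x_iy_j-x_jy_i|_\nu/(\max_i|x_i|_\nu\max_i|y_i|_\nu)$ (the constants below do not depend on this choice). For $Q_0\in V(\mathbb{Q}_\nu)$ and a subvariety $Y\subset V$, the approximation constant $\alpha^\nu(Q_0,Y)$ is the infimum of the $\gamma>0$ such that there exist infinitely many points $P\in Y(\mathbb{Q})$ with $d_\nu(P,Q_0)^\gamma H(P)<1$. The essential constant of $Q_0$ is $\alpha_{\mathrm{ess}}^\nu(Q_0)=\sup_{Y}\alpha^\nu(Q_0,Y)$, where $Y$ ranges over all open dense subvarieties of $V$ (over $\mathbb{Q}$). *)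

theory Defs
  imports "HOL-Analysis.Analysis" "HOL-Library.Poly_Mapping"
begin

definition projrel :: "'a::field^'n::finite \<Rightarrow> 'a^'n \<Rightarrow> bool" where
  "projrel x y \<longleftrightarrow> x \<noteq> 0 \<and> (\<exists>c. c \<noteq> 0 \<and> y = c *s x)"

lemma projrel_refl: "x \<noteq> 0 \<Longrightarrow> projrel x x"
  unfolding projrel_def by (intro conjI exI[of _ 1]) auto

lemma projrel_sym: "projrel x y \<Longrightarrow> projrel y x"
  unfolding projrel_def
proof (elim conjE exE)
  fix c assume "x \<noteq> 0" "c \<noteq> 0" "y = c *s x"
  then have "y \<noteq> 0 \<and> inverse c \<noteq> 0 \<and> x = inverse c *s y"
    by (auto simp: vec_eq_iff)
  then show "y \<noteq> 0 \<and> (\<exists>c. c \<noteq> 0 \<and> x = c *s y)" by blast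
qed

lemma projrel_trans: "projrel x y \<Longrightarrow> projrel y z \<Longrightarrow> projrel x z"
  unfolding projrel_def
proof (elim conjE exE)
  fix c d assume "x \<noteq> 0" "c \<noteq> 0" "y = c *s x" "d \<noteq> 0" "z = d *s y"
  then have "x \<noteq> 0 \<and> d * c \<noteq> 0 \<and> z = (d * c) *s x" by (auto simp: vec_eq_iff)
  then show "x \<noteq> 0 \<and> (\<exists>c. c \<noteq> 0 \<and> z = c *s x)" by blast
qed

text \<open>\<open>('a, 'n) proj\<close> is the set of \<open>'a\<close>-points of projective space with homogeneous
  coordinates indexed by \<open>'n\<close>. The point with coordinate vector \<open>x\<close> is \<open>abs_proj x\<close>, which is
  meaningful for \<open>x \<noteq> 0\<close> only.\<close>

quotient_type (overloaded) ('a, 'n) proj = "('a::field)^('n::finite)" / partial: projrel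
proof (rule part_equivpI)
  have "(axis undefined 1 :: 'a^'n) \<noteq> 0" by (simp add: axis_eq_0_iff)
  then show "\<exists>x :: 'a^'n. projrel x x" using projrel_refl by blast
  show "symp (projrel :: 'a^'n \<Rightarrow> _)" by (rule sympI) (rule projrel_sym)
  show "transp (projrel :: 'a^'n \<Rightarrow> _)" by (rule transpI) (rule projrel_trans)
qed

lemma abs_proj_eq_iff:
  assumes "x \<noteq> 0" "y \<noteq> 0"
  shows "abs_proj x = abs_proj y \<longleftrightarrow> (\<exists>c. c \<noteq> 0 \<and> y = c *s x)"
  using Quotient3_rel[OF Quotient3_proj, of x y] assms
  by (auto simp: projrel_refl) (auto simp: projrel_def)

lemma abs_proj_cases:
  obtains x where "x \<noteq> 0" "P = abs_proj x"
proof (induction P rule: proj.abs_induct)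
  case (1 y)
  then show ?case by (auto simp: projrel_def)
qed

lift_definition complex_point :: "(rat, 'n::finite) proj \<Rightarrow> (complex, 'n) proj" is
  "\<lambda>x. \<chi> i. of_rat (x $ i)"
proof -
  fix x y :: "rat^'n" assume "projrel x y"
  then obtain c where c: "x \<noteq> 0" "c \<noteq> 0" "y = c *s x" by (auto simp: projrel_def)
  have "(\<chi> i. of_rat (x $ i)) \<noteq> (0 :: complex^'n)" using c(1) by (auto simp: vec_eq_iff)
  moreover have "(of_rat c :: complex) \<noteq> 0" using c(2) by simp
  moreover have "(\<chi> i. of_rat (y $ i)) = (of_rat c :: complex) *s (\<chi> i. of_rat (x $ i))"
    using c(3) by (auto simp: vec_eq_iff of_rat_mult)
  ultimately show "projrel ((\<chi> i. of_rat (x $ i)) :: complex^'n) (\<chi> i. of_rat (y $ i))"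
    unfolding projrel_def by blast
qed

text \<open>A polynomial over \<open>'b\<close> in the variables indexed by \<open>'n\<close> is a finitely supported map
  from exponent vectors to coefficients.\<close>

type_synonym ('b, 'n) poly_ring = "('n \<Rightarrow>\<^sub>0 nat) \<Rightarrow>\<^sub>0 'b"

text \<open>Evaluation of \<open>f\<close> at \<open>x\<close>, coefficients being mapped into the target ring by \<open>\<phi>\<close>.\<close>

definition peval :: "('b::zero \<Rightarrow> 'a::comm_semiring_1) \<Rightarrow> ('b, 'n::finite) poly_ring \<Rightarrow> 'a^'n \<Rightarrow> 'a" where
  "peval \<phi> f x = (\<Sum>m\<in>Poly_Mapping.keys f.
     \<phi> (Poly_Mapping.lookup f m) * (\<Prod>i\<in>UNIV. x $ i ^ Poly_Mapping.lookup m i))"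

definition homogeneous :: "nat \<Rightarrow> ('b::zero, 'n::finite) poly_ring \<Rightarrow> bool" where
  "homogeneous d f \<longleftrightarrow> (\<forall>m\<in>Poly_Mapping.keys f. (\<Sum>i\<in>UNIV. Poly_Mapping.lookup m i) = d)"

definition zero_locus :: "('b::zero \<Rightarrow> complex) \<Rightarrow> ('b, 'n::finite) poly_ring \<Rightarrow> (complex, 'n) proj set" where
  "zero_locus \<phi> f = {P. \<forall>x. x \<noteq> 0 \<and> P = abs_proj x \<longrightarrow> peval \<phi> f x = 0}"

text \<open>A variety over the rationals is represented by its set of complex points. Its open
  subvarieties over the rationals are the traces of the open sets of the following topology, whose
  closed sets are the common zero loci of rational forms. As the complex numbers have infinite
  transcendence degree over the rationals, every scheme-theoretic point is the image of a complex
  point, so that density in this topology is density in the underlying scheme.\<close>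

definition zariski :: "(complex, 'n::finite) proj topology" where
  "zariski = topology_generated_by
     {- zero_locus of_rat f | f :: (rat, 'n) poly_ring. \<exists>d. homogeneous d f}"

definition open_dense_subvarieties :: "(complex, 'n::finite) proj set \<Rightarrow> (complex, 'n) proj set set" where
  "open_dense_subvarieties V = {Y. openin (subtopology zariski V) Y \<and>
     (subtopology zariski V) closure_of Y = V}"

definition rational_points :: "(complex, 'n::finite) proj set \<Rightarrow> (rat, 'n) proj set" where
  "rational_points Y = {P. complex_point P \<in> Y}"

lemma homogeneous_one: "homogeneous 0 (1 :: (rat, 'n::finite) poly_ring)"
  by (simp add: homogeneous_def)

lemma topspace_zariski: "topspace zariski = (UNIV :: (complex, 'n::finite) proj set)"
proof -
  have "zero_locus of_rat (1 :: (rat, 'n) poly_ring) = {}"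
    unfolding zero_locus_def by (auto simp: peval_def) (metis abs_proj_cases)
  then have "- {} \<in> {- zero_locus of_rat f | f :: (rat, 'n) poly_ring. \<exists>d. homogeneous d f}"
    using homogeneous_one by blast
  then show ?thesis unfolding zariski_def topology_generated_by_topspace by blast
qed

abbreviation quadratic_form :: "(int, 'n::finite) poly_ring \<Rightarrow> bool" where
  "quadratic_form F \<equiv> homogeneous 2 F"

definition polar_form :: "(int, 'n::finite) poly_ring \<Rightarrow> rat^'n \<Rightarrow> rat^'n \<Rightarrow> rat" where
  "polar_form F x y = peval of_int F (x + y) - peval of_int F x - peval of_int F y"

definition nondegenerate :: "(int, 'n::finite) poly_ring \<Rightarrow> bool" where
  "nondegenerate F \<longleftrightarrow> (\<forall>x. (\<forall>y. polar_form F x y = 0) \<longrightarrow> x = 0)"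

abbreviation quadric :: "(int, 'n::finite) poly_ring \<Rightarrow> (complex, 'n) proj set" where
  "quadric F \<equiv> zero_locus of_int F"

definition height :: "(rat, 'n::finite) proj \<Rightarrow> real" where
  "height P = (THE h. \<exists>z :: int^'n. Gcd (range (($) z)) = 1 \<and>
     P = abs_proj (\<chi> i. of_int (z $ i)) \<and> h = Max (range (\<lambda>i. \<bar>real_of_int (z $ i)\<bar>)))"

lemma height_primitive:
  fixes z :: "int^'n::finite"
  assumes z: "Gcd (range (($) z)) = 1"
  shows "height (abs_proj (\<chi> i. of_int (z $ i))) = Max (range (\<lambda>i. \<bar>real_of_int (z $ i)\<bar>))"
  unfolding height_def
proof (rule the_equality)
  show "\<exists>w :: int^'n. Gcd (range (($) w)) = 1 \<and>
     abs_proj ((\<chi> i. of_int (z $ i)) :: rat^'n) = abs_proj (\<chi> i. of_int (w $ i)) \<and>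
     Max (range (\<lambda>i. \<bar>real_of_int (z $ i)\<bar>)) = Max (range (\<lambda>i. \<bar>real_of_int (w $ i)\<bar>))"
    using z by blast
next
  fix h assume "\<exists>w :: int^'n. Gcd (range (($) w)) = 1 \<and>
     abs_proj ((\<chi> i. of_int (z $ i)) :: rat^'n) = abs_proj (\<chi> i. of_int (w $ i)) \<and>
     h = Max (range (\<lambda>i. \<bar>real_of_int (w $ i)\<bar>))"
  then obtain w :: "int^'n" where w: "Gcd (range (($) w)) = 1"
    and e: "abs_proj ((\<chi> i. of_int (z $ i)) :: rat^'n) = abs_proj (\<chi> i. of_int (w $ i))"
    and h: "h = Max (range (\<lambda>i. \<bar>real_of_int (w $ i)\<bar>))" by blast
  have nz: "(\<chi> i. of_int (u $ i)) \<noteq> (0 :: rat^'n)" if "Gcd (range (($) u)) = 1" for u :: "int^'n"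
  proof
    assume "(\<chi> i. of_int (u $ i)) = (0 :: rat^'n)"
    then have "range (($) u) \<subseteq> {0}" by (auto simp: vec_eq_iff)
    then have "Gcd (range (($) u)) = 0" by (simp add: Gcd_0_iff)
    with that show False by simp
  qed
  from e obtain c :: rat where c: "(\<chi> i. of_int (w $ i)) = c *s (\<chi> i. of_int (z $ i))"
    unfolding abs_proj_eq_iff[OF nz[OF z] nz[OF w]] by blast
  obtain a b where ab: "c = Fract a b" "b > 0" by (cases c) auto
  have "b * w $ i = a * z $ i" for i
  proof -
    have "(of_int (w $ i) :: rat) = c * of_int (z $ i)" using c by (simp add: vec_eq_iff)
    then have "(of_int (b * w $ i) :: rat) = of_int (a * z $ i)"
      using ab by (simp add: Fract_of_int_quotient field_simps)
    then show ?thesis by (simp only: of_int_eq_iff)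
  qed
  then have "(*) b ` range (($) w) = (*) a ` range (($) z)" by (simp add: image_image)
  then have "Gcd ((*) b ` range (($) w)) = Gcd ((*) a ` range (($) z))" by simp
  then have "\<bar>b\<bar> = \<bar>a\<bar>" using z w by (simp add: Gcd_mult)
  moreover have "\<bar>b\<bar> * \<bar>w $ i\<bar> = \<bar>a\<bar> * \<bar>z $ i\<bar>" for i
    using \<open>\<And>i. b * w $ i = a * z $ i\<close> by (metis abs_mult)
  ultimately have "\<bar>w $ i\<bar> = \<bar>z $ i\<bar>" for i using ab(2) by (metis abs_0_eq less_irrefl mult_cancel_left)
  then show "h = Max (range (\<lambda>i. \<bar>real_of_int (z $ i)\<bar>))"
    unfolding h by (simp flip: of_int_abs)
qed

typedef prime_number = "{p :: nat. prime p}"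
  using two_is_prime_nat by blast

datatype place = Real_place | Padic_place prime_number

definition padic_abs :: "nat \<Rightarrow> rat \<Rightarrow> real" where
  "padic_abs p x = (if x = 0 then 0 else case quotient_of x of (a, b) \<Rightarrow>
     real p powi (int (multiplicity (int p) b) - int (multiplicity (int p) a)))"

fun place_abs :: "place \<Rightarrow> rat \<Rightarrow> real" where
  "place_abs Real_place x = \<bar>of_rat x\<bar>"
| "place_abs (Padic_place p) x = padic_abs (Rep_prime_number p) x"

lemma padic_abs_Fract:
  assumes p: "prime p" and ab: "a \<noteq> 0" "b \<noteq> 0"
  shows "padic_abs p (Fract a b) =
    real p powi (int (multiplicity (int p) b) - int (multiplicity (int p) a))"
proof -
  obtain c d where q: "quotient_of (Fract a b) = (c, d)" by fastforce
  have d: "d > 0" using quotient_of_denom_pos[OF q] .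
  have e: "Fract a b = Fract c d"
    using quotient_of_div[OF q] by (simp add: Fract_of_int_quotient)
  then have 1: "a * d = c * b" using ab d by (simp add: eq_rat)
  have c: "c \<noteq> 0" using 1 ab d by auto
  have P: "prime_elem (int p)" using p by simp
  have "multiplicity (int p) (a * d) = multiplicity (int p) (c * b)" using 1 by simp
  then have "multiplicity (int p) a + multiplicity (int p) d
      = multiplicity (int p) c + multiplicity (int p) b"
    using ab c d P by (simp add: prime_elem_multiplicity_mult_distrib)
  then have "int (multiplicity (int p) d) - int (multiplicity (int p) c) =
     int (multiplicity (int p) b) - int (multiplicity (int p) a)" by linarith
  moreover have "Fract a b \<noteq> 0" using ab by (simp add: Zero_rat_def eq_rat)
  ultimately show ?thesis unfolding padic_abs_def q by simp
qed

lemma padic_abs_mult: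
  assumes p: "prime p"
  shows "padic_abs p (x * y) = padic_abs p x * padic_abs p y"
proof (cases "x = 0 \<or> y = 0")
  case True then show ?thesis by (auto simp: padic_abs_def)
next
  case False
  obtain a b where x: "x = Fract a b" "b > 0" by (cases x) auto
  obtain c d where y: "y = Fract c d" "d > 0" by (cases y) auto
  have nz: "a \<noteq> 0" "b \<noteq> 0" "c \<noteq> 0" "d \<noteq> 0" using False x y by (auto simp: rat_number_collapse)
  have P: "prime_elem (int p)" using p by simp
  have rp: "p \<noteq> 0" using p by (metis not_prime_0)
  show ?thesis unfolding x(1) y(1) mult_rat
    using nz by (simp add: padic_abs_Fract[OF p] prime_elem_multiplicity_mult_distrib[OF P]
      power_int_diff power_int_add rp field_simps)
qed

lemma place_abs_mult: "place_abs v (x * y) = place_abs v x * place_abs v y"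
  using Rep_prime_number by (cases v) (auto simp: padic_abs_mult of_rat_mult abs_mult)

lemma place_abs_nonneg: "place_abs v x \<ge> 0"
  by (cases v) (auto simp: padic_abs_def split: prod.split)

lemma place_abs_eq_0_iff [simp]: "place_abs v x = 0 \<longleftrightarrow> x = 0"
proof (cases v)
  case (Padic_place p)
  have "real (Rep_prime_number p) \<noteq> 0" using Rep_prime_number[of p] by (auto simp: prime_gt_0_nat)
  then show ?thesis using Padic_place by (auto simp: padic_abs_def split: prod.split)
qed auto

lemma Max_range_scale:
  fixes f :: "'i::finite \<Rightarrow> real"
  assumes "c \<ge> 0"
  shows "Max (range (\<lambda>i. c * f i)) = c * Max (range f)"
proof -
  have "mono ((*) c)" using assms by (auto intro!: monoI mult_left_mono)
  from mono_Max_commute[OF this, of "range f"] show ?thesis by (simp add: image_image)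
qed

text \<open>All ordered pairs of indices are allowed in the numerator, so no order on \<open>'n\<close> is needed;
  diagonal pairs contribute \<open>0\<close>.\<close>

lift_definition proj_dist :: "place \<Rightarrow> (rat, 'n::finite) proj \<Rightarrow> (rat, 'n) proj \<Rightarrow> real" is
  "\<lambda>v x y. Max (range (\<lambda>(i, j). place_abs v (x $ i * y $ j - x $ j * y $ i)))
     / (Max (range (\<lambda>i. place_abs v (x $ i))) * Max (range (\<lambda>i. place_abs v (y $ i))))"
proof -
  fix v and x x' y y' :: "rat^'n"
  assume "projrel x x'" "projrel y y'"
  then obtain c d where c: "c \<noteq> 0" "x' = c *s x" and d: "d \<noteq> 0" "y' = d *s y"
    by (auto simp: projrel_def)
  let ?c = "place_abs v c" and ?d = "place_abs v d"
  have nz: "?c \<noteq> 0" "?d \<noteq> 0" using c d by auto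
  have "(\<lambda>(i, j). place_abs v (x' $ i * y' $ j - x' $ j * y' $ i))
    = (\<lambda>p. (?c * ?d) * (case p of (i, j) \<Rightarrow> place_abs v (x $ i * y $ j - x $ j * y $ i)))"
    unfolding c d by (auto simp: fun_eq_iff place_abs_mult[symmetric] algebra_simps)
  then have 1: "Max (range (\<lambda>(i, j). place_abs v (x' $ i * y' $ j - x' $ j * y' $ i)))
    = (?c * ?d) * Max (range (\<lambda>(i, j). place_abs v (x $ i * y $ j - x $ j * y $ i)))"
    by (simp only: Max_range_scale mult_nonneg_nonneg place_abs_nonneg)
  have 2: "Max (range (\<lambda>i. place_abs v (x' $ i))) = ?c * Max (range (\<lambda>i. place_abs v (x $ i)))"
    and 3: "Max (range (\<lambda>i. place_abs v (y' $ i))) = ?d * Max (range (\<lambda>i. place_abs v (y $ i)))"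
    unfolding c d by (simp_all add: place_abs_mult Max_range_scale place_abs_nonneg)
  show "Max (range (\<lambda>(i, j). place_abs v (x $ i * y $ j - x $ j * y $ i)))
     / (Max (range (\<lambda>i. place_abs v (x $ i))) * Max (range (\<lambda>i. place_abs v (y $ i))))
   = Max (range (\<lambda>(i, j). place_abs v (x' $ i * y' $ j - x' $ j * y' $ i)))
     / (Max (range (\<lambda>i. place_abs v (x' $ i))) * Max (range (\<lambda>i. place_abs v (y' $ i))))"
    unfolding 1 2 3 using nz by (simp add: field_simps)
qed

text \<open>The infimum over the empty set is \<open>\<infinity>\<close>.\<close>

definition approx_const :: "place \<Rightarrow> (rat, 'n::finite) proj \<Rightarrow> (complex, 'n) proj set \<Rightarrow> ereal" where
  "approx_const v Q Y = Inf (ereal ` {\<gamma>. \<gamma> > 0 \<and>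
     infinite {P \<in> rational_points Y. proj_dist v P Q powr \<gamma> * height P < 1}})"

definition ess_const :: "place \<Rightarrow> (rat, 'n::finite) proj \<Rightarrow> (complex, 'n) proj set \<Rightarrow> ereal" where
  "ess_const v Q V = (SUP Y\<in>open_dense_subvarieties V. approx_const v Q Y)"

end

theory Submission
  imports Defs "HOL-Computational_Algebra.Polynomial"
begin

text \<open>Why the constant is \<open>2\<close>. Let \<open>y\<close> be primitive integer coordinates of \<open>Q\<^sub>0\<close>, let \<open>\<langle>\<cdot>,\<cdot>\<rangle>\<close> be
  the polar form of \<open>F\<close>, and let \<open>T\<close> be the tangent hyperplane \<open>\<langle>y, x\<rangle> = 0\<close>.

  Rational points off \<open>T\<close> cannot be too close. For two points of the quadric the value \<open>\<langle>y, x\<rangle>\<close> is,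
  up to scaling, the value of \<open>F\<close> at their difference, so it is of second order in the distance:
  \<open>\<bar>\<langle>y, x\<rangle>\<bar>\<^sub>v \<lesssim> d\<^sup>2\<close> in normalised coordinates (\<open>int_abs_polar_le_proj_dist\<close>). If \<open>x\<close> is integral and
  \<open>\<langle>y, x\<rangle>\<close> is nonzero, this is the \<open>v\<close>-adic value of a nonzero integer of size \<open>O(H(x))\<close>, which
  cannot be small (\<open>vnorm_mult_le\<close>). Together they give \<open>1 \<le> K H d\<^sup>2\<close>
  (\<open>height_mult_dist_square_ge\<close>). With finiteness of the set of points of bounded height, an exponent
  below \<open>2\<close> admits only finitely many points of \<open>V - T\<close>; and \<open>V - T\<close> is open and dense because \<open>V\<close>
  is irreducible.

  Conversely, every open dense \<open>Y\<close> meets enough rational conics through \<open>Q\<^sub>0\<close>. The second intersection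
  of \<open>V\<close> with the line from \<open>y\<close> to \<open>w\<close> is \<open>F(w) y - \<langle>y, w\<rangle> w\<close>; with \<open>w = s w\<^sub>0 + t w\<^sub>1\<close>, where
  \<open>w\<^sub>0\<close> is tangent at \<open>y\<close> and anisotropic, it is a quadratic form in \<open>(s, t)\<close> and equals \<open>Q\<^sub>0\<close> at
  \<open>t = 0\<close>. Integers \<open>s\<close>, \<open>t\<close> of size at most \<open>N\<close> for which \<open>s / t\<close> has \<open>v\<close>-adic value \<open>N\<close> yield a
  point of height \<open>O(N\<^sup>2)\<close> at distance \<open>O(1 / N)\<close> from \<open>Q\<^sub>0\<close> (\<open>conic_approximation\<close>), so every exponent
  above \<open>2\<close> admits infinitely many points. Since a nonzero polynomial does not vanish at all integer
  vectors, \<open>w\<^sub>1\<close> can be chosen such that the conic is not contained in the complement of \<open>Y\<close>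
  (\<open>approximating_points\<close>).\<close>

section \<open>Quadratic forms given by an integer matrix\<close>

definition of_int_vec :: "int^'n \<Rightarrow> 'a::ring_1^'n::finite" where
  "of_int_vec z = (\<chi> i. of_int (z $ i))"

lemma of_int_vec_nth [simp]: "of_int_vec z $ i = of_int (z $ i)"
  by (simp add: of_int_vec_def)

lemma of_int_vec_eq_0_iff [simp]: "(of_int_vec z :: 'a::ring_char_0^'n::finite) = 0 \<longleftrightarrow> z = 0"
  by (simp add: vec_eq_iff)

lemma of_int_vec_hom:
  "of_int_vec (x + y) = of_int_vec x + of_int_vec y"
  "of_int_vec (x - y) = of_int_vec x - of_int_vec y"
  "of_int_vec (c *s x) = (of_int c :: 'a::comm_ring_1) *s of_int_vec x"
  by (simp_all add: vec_eq_iff)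

text \<open>The ring of values is arbitrary so that the same integer matrix \<open>A\<close> can be evaluated at
  integer, rational and complex vectors.\<close>

definition quad :: "int^'n^'n \<Rightarrow> 'a::comm_ring_1^'n \<Rightarrow> 'a" where
  "quad A x = (\<Sum>i\<in>UNIV. \<Sum>j\<in>UNIV. of_int (A $ i $ j) * (x $ i * x $ j))"

definition polar :: "int^'n^'n \<Rightarrow> 'a::comm_ring_1^'n \<Rightarrow> 'a^'n \<Rightarrow> 'a" where
  "polar A x y = (\<Sum>i\<in>UNIV. \<Sum>j\<in>UNIV. of_int (A $ i $ j) * (x $ i * y $ j + y $ i * x $ j))"

lemma polar_add_right: "polar A x (y + z) = polar A x y + polar A x z"
  by (simp add: polar_def sum.distrib [symmetric] algebra_simps)

lemma polar_scale_right: "polar A x (c *s y) = c * polar A x y"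
  by (simp add: polar_def sum_distrib_left algebra_simps)

lemma polar_commute: "polar A x y = polar A y x"
  by (simp add: polar_def algebra_simps)

lemma polar_scale_left: "polar A (c *s x) y = c * polar A x y"
  by (metis polar_scale_right polar_commute)

lemma polar_diff_right: "polar A x (y - z) = polar A x y - polar A x z"
  by (metis add_diff_cancel polar_add_right diff_add_cancel)

lemma polar_diff_left: "polar A (x - y) z = polar A x z - polar A y z"
  by (metis polar_diff_right polar_commute)

lemma polar_self: "polar A x x = 2 * quad A x"
  by (simp add: polar_def quad_def sum_distrib_left algebra_simps)

lemma quad_add: "quad A (x + y) = quad A x + quad A y + polar A x y"
  by (simp add: quad_def polar_def sum.distrib [symmetric] algebra_simps)

lemma quad_scale: "quad A (c *s x) = c\<^sup>2 * quad A x"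
  by (simp add: quad_def sum_distrib_left power2_eq_square algebra_simps)

lemma quad_diff: "quad A (x - y) = quad A x + quad A y - polar A x y"
proof -
  have "quad A (x + (-1) *s y) = quad A x + quad A y - polar A x y"
    by (simp only: quad_add quad_scale polar_scale_right) simp
  moreover have "x + (-1) *s y = x - y" by (simp add: vec_eq_iff)
  ultimately show ?thesis by simp
qed

lemma quad_of_int_vec: "quad A (of_int_vec x) = of_int (quad A x)"
  by (simp add: quad_def)

lemma polar_of_int_vec: "polar A (of_int_vec x) (of_int_vec y) = of_int (polar A x y)"
  by (simp add: polar_def)

lemma polar_eq_matrix:
  "polar A x y = (\<Sum>j\<in>UNIV. (\<Sum>i\<in>UNIV. of_int (A $ i $ j + A $ j $ i) * x $ i) * y $ j)"
proof -
  have "polar A x y = (\<Sum>i\<in>UNIV. \<Sum>j\<in>UNIV. of_int (A $ i $ j) * (x $ i * y $ j)) +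
     (\<Sum>i\<in>UNIV. \<Sum>j\<in>UNIV. of_int (A $ i $ j) * (y $ i * x $ j))"
    by (simp add: polar_def sum.distrib distrib_left)
  also have "(\<Sum>i\<in>UNIV. \<Sum>j\<in>UNIV. of_int (A $ i $ j) * (x $ i * y $ j)) =
      (\<Sum>j\<in>UNIV. \<Sum>i\<in>UNIV. of_int (A $ i $ j) * (x $ i * y $ j))"
    by (rule sum.swap)
  finally show ?thesis
    by (simp add: sum.distrib sum_distrib_left sum_distrib_right algebra_simps)
qed

text \<open>Injectivity of the rational Gram matrix gives it a left inverse, and the identity
  between rational matrices can be read over the complex numbers.\<close>

lemma nondegenerate_complex:
  fixes A :: "int^'n^'n::finite" and x :: "complex^'n"
  assumes nd: "\<And>x :: rat^'n. (\<And>y. polar A x y = 0) \<Longrightarrow> x = 0"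
    and x: "\<And>y. polar A x y = 0"
  shows "x = 0"
proof -
  define M :: "rat^'n^'n" where "M = (\<chi> j i. of_int (A $ i $ j + A $ j $ i))"
  have "z = 0" if "M *v z = 0" for z
  proof (rule nd)
    fix y
    have "polar A z y = (\<Sum>j\<in>UNIV. (M *v z) $ j * y $ j)"
      by (simp add: polar_eq_matrix M_def matrix_vector_mult_def)
    then show "polar A z y = 0" using that by simp
  qed
  then have "\<exists>N. N ** M = mat 1"
    unfolding matrix_left_invertible_ker by simp
  then obtain N where N: "N ** M = mat 1" ..
  have z: "(\<Sum>i\<in>UNIV. of_int (A $ i $ j + A $ j $ i) * x $ i) = 0" for j
    using x[of "axis j 1"] unfolding polar_eq_matrix axis_def
    by (simp add: if_distrib[of "\<lambda>a. _ * a"] cong: if_cong del: of_int_add)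
  have "x $ k = 0" for k
  proof -
    have of_rat_if: "of_rat (if b then 1 else 0) * z = (if b then z else 0)" for b and z :: complex
      by simp
    have e: "(\<Sum>j\<in>UNIV. N $ k $ j * M $ j $ i) = (if k = i then 1 else 0)" for i
      using N by (auto simp: vec_eq_iff matrix_matrix_mult_def mat_def)
    have "0 = (\<Sum>j\<in>UNIV. of_rat (N $ k $ j) *
        (\<Sum>i\<in>UNIV. of_int (A $ i $ j + A $ j $ i) * x $ i))"
      by (simp only: z) simp
    also have "\<dots> = (\<Sum>j\<in>UNIV. \<Sum>i\<in>UNIV. of_rat (N $ k $ j * M $ j $ i) * x $ i)"
      by (simp add: M_def sum_distrib_left of_rat_mult of_rat_add mult.assoc)
    also have "\<dots> = (\<Sum>i\<in>UNIV. \<Sum>j\<in>UNIV. of_rat (N $ k $ j * M $ j $ i) * x $ i)"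
      by (rule sum.swap)
    also have "\<dots> = (\<Sum>i\<in>UNIV. of_rat (\<Sum>j\<in>UNIV. N $ k $ j * M $ j $ i) * x $ i)"
      by (simp add: of_rat_sum sum_distrib_right)
    also have "\<dots> = x $ k" by (simp add: e of_rat_if)
    finally show ?thesis by simp
  qed
  then show ?thesis by (simp add: vec_eq_iff)
qed

text \<open>If \<open>x\<^sup>\<bottom>\<close> were totally isotropic, the form would pair it with itself trivially, hence would
  see its vectors only through their pairing with one vector \<open>u\<close> outside \<open>x\<^sup>\<bottom>\<close>. Then \<open>x\<^sup>\<bottom>\<close> would
  be a line, and \<open>x\<close> and \<open>u\<close> would span the whole space, of dimension at least 3.\<close>

lemma exists_anisotropic_orthogonal:
  fixes x :: "'a::field^'n::finite"
  assumes nd: "\<And>x :: 'a^'n. (\<And>y. polar A x y = 0) \<Longrightarrow> x = 0"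
    and card: "CARD('n) \<ge> 3" and x: "x \<noteq> 0" "quad A x = 0"
  shows "\<exists>w. polar A x w = 0 \<and> quad A w \<noteq> 0"
proof (rule ccontr)
  assume "\<nexists>w. polar A x w = 0 \<and> quad A w \<noteq> 0"
  then have iso: "quad A w = 0" if "polar A x w = 0" for w using that by blast
  have iso2: "polar A w z = 0" if "polar A x w = 0" "polar A x z = 0" for w z
    using iso[of "w + z"] iso[of w] iso[of z] that by (simp add: quad_add polar_add_right)
  obtain u where u: "polar A x u \<noteq> 0" using nd x(1) by blast
  have xx: "polar A x x = 0" using x by (simp add: polar_self)
  have dep: "polar A x u *s w = polar A w u *s x" if w: "polar A x w = 0" for w
  proof -
    define k where "k = polar A x u *s w - polar A w u *s x"
    have kx: "polar A x k = 0" by (simp add: k_def polar_diff_right polar_scale_right w xx)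
    have ku: "polar A k u = 0" by (simp add: k_def polar_diff_left polar_scale_left)
    have "k = 0"
    proof (rule nd)
      fix y
      define z where "z = polar A x u *s y - polar A x y *s u"
      have "polar A x z = 0" by (simp add: z_def polar_diff_right polar_scale_right)
      then have "polar A k z = 0" using iso2 kx by blast
      then show "polar A k y = 0" using u ku by (simp add: z_def polar_diff_right polar_scale_right)
    qed
    then show ?thesis by (simp add: k_def)
  qed
  have "y \<in> vec.span {x, u}" for y
  proof -
    define w where "w = y - (polar A x y / polar A x u) *s u"
    have "polar A x w = 0" using u by (simp add: w_def polar_diff_right polar_scale_right)
    from dep[OF this] have "inverse (polar A x u) *s (polar A x u *s w) = inverse (polar A x u) *s (polar A w u *s x)"
      by simp
    then have w: "w = (inverse (polar A x u) * polar A w u) *s x"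
      using u by (simp add: vector_smult_assoc)
    have "y = w + (polar A x y / polar A x u) *s u" by (simp add: w_def)
    moreover have "w \<in> vec.span {x, u}" by (subst w) (intro vec.span_scale vec.span_base, simp)
    moreover have "(polar A x y / polar A x u) *s u \<in> vec.span {x, u}" by (intro vec.span_scale vec.span_base) simp
    ultimately show ?thesis by (metis vec.span_add)
  qed
  then have "vec.dim (UNIV :: ('a^'n) set) \<le> card {x, u}"
    by (intro vec.dim_le_card) auto
  moreover have "card {x, u} \<le> 2" by (simp add: card_insert_if)
  ultimately show False using card by (simp add: card_cart_basis)
qed

text \<open>Over a field, when \<open>y\<close> lies on the quadric, this is the second point of the quadric on the
  line joining \<open>y\<close> to \<open>w\<close>: the inverse of stereographic projection from \<open>y\<close>, without
  denominators.\<close>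

definition second_point :: "int^'n^'n \<Rightarrow> 'a::comm_ring_1^'n \<Rightarrow> 'a^'n \<Rightarrow> 'a^'n" where
  "second_point A y w = quad A w *s y - polar A y w *s w"

lemma quad_second_point:
  assumes "quad A y = 0"
  shows "quad A (second_point A y w) = 0"
  using assms
  by (simp add: second_point_def quad_diff quad_scale polar_scale_left polar_scale_right power2_eq_square)

lemma polar_second_point:
  assumes "quad A y = 0"
  shows "polar A y (second_point A y w) = - (polar A y w)\<^sup>2"
  using assms
  by (simp add: second_point_def polar_diff_right polar_scale_right polar_self power2_eq_square)

lemma second_point_of_int_vec:
  "second_point A (of_int_vec y) (of_int_vec w) = of_int_vec (second_point A y w)"
  by (simp add: second_point_def of_int_vec_hom quad_of_int_vec polar_of_int_vec)

lemma second_point_scale: "second_point A y (c *s w) = c\<^sup>2 *s second_point A y w"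
  by (simp add: second_point_def quad_scale polar_scale_right vec_eq_iff power2_eq_square algebra_simps)

text \<open>A monomial of degree 2 is a product of two variables, so that a quadratic form can be sorted
  into a matrix.\<close>

lemma monomial_degree_2:
  fixes m :: "'n::finite \<Rightarrow>\<^sub>0 nat"
  assumes "(\<Sum>i\<in>UNIV. Poly_Mapping.lookup m i) = 2"
  shows "\<exists>i j. \<forall>k. Poly_Mapping.lookup m k = of_bool (k = i) + of_bool (k = j)"
proof -
  let ?l = "Poly_Mapping.lookup m"
  obtain i where i: "?l i \<noteq> 0" using assms by (metis sum.neutral zero_neq_numeral)
  have 1: "?l i + (\<Sum>k\<in>UNIV - {i}. ?l k) = 2"
    using assms by (simp add: sum.remove[of _ i])
  show ?thesis
  proof (cases "?l i = 2")
    case True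
    then have "?l k = 0" if "k \<noteq> i" for k using 1 that by simp
    with True have "\<forall>k. ?l k = of_bool (k = i) + of_bool (k = i)" by auto
    then show ?thesis by blast
  next
    case False
    then have l: "?l i = 1" and s: "(\<Sum>k\<in>UNIV - {i}. ?l k) = 1" using 1 i by linarith+
    then obtain j where j: "j \<noteq> i" "?l j \<noteq> 0"
      by (metis DiffD2 insertI1 sum.neutral zero_neq_one)
    have "?l j + (\<Sum>k\<in>UNIV - {i} - {j}. ?l k) = 1"
      using s j by (subst (asm) sum.remove[of _ j]) auto
    then have "?l j = 1" "(\<Sum>k\<in>UNIV - {i} - {j}. ?l k) = 0" using j by linarith+
    then have "\<forall>k. ?l k = of_bool (k = i) + of_bool (k = j)" using l j by auto
    then show ?thesis by blast
  qed
qed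

lemma peval_eq_quad:
  fixes F :: "(int, 'n::finite) poly_ring" and x :: "'a::comm_ring_1^'n"
  assumes IJ: "\<And>m k. m \<in> Poly_Mapping.keys F \<Longrightarrow>
      Poly_Mapping.lookup m k = of_bool (k = I m) + of_bool (k = J m)"
  shows "peval of_int F x = quad (\<chi> i j. \<Sum>m\<in>{m \<in> Poly_Mapping.keys F. I m = i \<and> J m = j}. Poly_Mapping.lookup F m) x"
proof -
  let ?K = "Poly_Mapping.keys F" and ?l = "Poly_Mapping.lookup F"
  have p: "(\<Prod>k\<in>UNIV. x $ k ^ Poly_Mapping.lookup m k) = x $ I m * x $ J m" if "m \<in> ?K" for m
  proof -
    have "(\<Prod>k\<in>UNIV. x $ k ^ Poly_Mapping.lookup m k) =
        (\<Prod>k\<in>UNIV. (if k = I m then x $ k else 1) * (if k = J m then x $ k else 1))"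
      using IJ[OF that] by (intro prod.cong) auto
    also have "\<dots> = x $ I m * x $ J m" by (simp add: prod.distrib)
    finally show ?thesis .
  qed
  have "quad (\<chi> i j. \<Sum>m\<in>{m \<in> ?K. I m = i \<and> J m = j}. ?l m) x =
     (\<Sum>i\<in>UNIV. \<Sum>j\<in>UNIV. \<Sum>m\<in>{m \<in> ?K. I m = i \<and> J m = j}. of_int (?l m) * (x $ i * x $ j))"
    by (simp add: quad_def sum_distrib_right)
  also have "\<dots> = (\<Sum>i\<in>UNIV. \<Sum>j\<in>UNIV. \<Sum>m\<in>?K.
      if I m = i \<and> J m = j then of_int (?l m) * (x $ i * x $ j) else 0)"
    by (simp only: sum.inter_filter finite_keys)
  also have "\<dots> = (\<Sum>(i, j)\<in>UNIV \<times> UNIV. \<Sum>m\<in>?K.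
      if I m = i \<and> J m = j then of_int (?l m) * (x $ i * x $ j) else 0)"
    by (rule sum.cartesian_product)
  also have "\<dots> = (\<Sum>m\<in>?K. \<Sum>(i, j)\<in>UNIV \<times> UNIV.
      if I m = i \<and> J m = j then of_int (?l m) * (x $ i * x $ j) else 0)"
    unfolding case_prod_unfold by (rule sum.swap)
  also have "\<dots> = (\<Sum>m\<in>?K. of_int (?l m) * (x $ I m * x $ J m))"
  proof (rule sum.cong[OF refl])
    fix m
    have "(\<Sum>(i, j)\<in>UNIV \<times> UNIV. if I m = i \<and> J m = j then of_int (?l m) * (x $ i * x $ j) else 0)
      = (\<Sum>p\<in>UNIV. if p = (I m, J m) then of_int (?l m) * (x $ I m * x $ J m) else 0)"
      by (rule sum.cong) (auto split: if_splits)
    then show "(\<Sum>(i, j)\<in>UNIV \<times> UNIV. if I m = i \<and> J m = j then of_int (?l m) * (x $ i * x $ j) else 0)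
       = of_int (?l m) * (x $ I m * x $ J m)" by simp
  qed
  finally show ?thesis unfolding peval_def using p by simp
qed

lemma quadratic_form_matrix:
  fixes F :: "(int, 'n::finite) poly_ring"
  assumes "quadratic_form F"
  obtains A :: "int^'n^'n" where
    "\<And>x :: rat^'n. peval of_int F x = quad A x" "\<And>x :: complex^'n. peval of_int F x = quad A x"
proof -
  have "\<forall>m\<in>Poly_Mapping.keys F. \<exists>i j. \<forall>k. Poly_Mapping.lookup m k = of_bool (k = i) + of_bool (k = j)"
    using assms monomial_degree_2 unfolding homogeneous_def by blast
  then obtain I J where IJ: "\<And>m k. m \<in> Poly_Mapping.keys F \<Longrightarrow>
      Poly_Mapping.lookup m k = of_bool (k = I m) + of_bool (k = J m)" by metis
  show ?thesis
    by (rule that; rule peval_eq_quad[of F I J]; rule IJ)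
qed

section \<open>Polynomial functions and Zariski open sets\<close>

text \<open>Being polynomial along every polynomial curve is all that is needed of a polynomial in several
  variables: it is stable under composition and reduces questions about zeros to one variable.\<close>

definition polyfun :: "(complex^'n \<Rightarrow> complex) \<Rightarrow> bool" where
  "polyfun g \<longleftrightarrow> (\<forall>u :: complex poly^'n. \<exists>q. \<forall>t. g (\<chi> i. poly (u $ i) t) = poly q t)"

lemma polyfunI:
  "(\<And>u. \<exists>q. \<forall>t. g (\<chi> i. poly (u $ i) t) = poly q t) \<Longrightarrow> polyfun g"
  by (simp add: polyfun_def)

lemma polyfun_const: "polyfun (\<lambda>x. c)"
  by (intro polyfunI exI[of _ "[:c:]"]) simp

lemma polyfun_component: "polyfun (\<lambda>x. x $ i)"
  by (rule polyfunI) auto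

lemma polyfun_add:
  fixes f g :: "complex^'n \<Rightarrow> complex"
  assumes "polyfun f" "polyfun g"
  shows "polyfun (\<lambda>x. f x + g x)"
proof (rule polyfunI)
  fix u :: "complex poly^'n"
  from assms obtain p q where "\<forall>t. f (\<chi> i. poly (u $ i) t) = poly p t"
    "\<forall>t. g (\<chi> i. poly (u $ i) t) = poly q t" unfolding polyfun_def by metis
  then show "\<exists>q. \<forall>t. f (\<chi> i. poly (u $ i) t) + g (\<chi> i. poly (u $ i) t) = poly q t"
    by (intro exI[of _ "p + q"]) simp
qed

lemma polyfun_mult:
  fixes f g :: "complex^'n \<Rightarrow> complex"
  assumes "polyfun f" "polyfun g"
  shows "polyfun (\<lambda>x. f x * g x)"
proof (rule polyfunI)
  fix u :: "complex poly^'n"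
  from assms obtain p q where "\<forall>t. f (\<chi> i. poly (u $ i) t) = poly p t"
    "\<forall>t. g (\<chi> i. poly (u $ i) t) = poly q t" unfolding polyfun_def by metis
  then show "\<exists>q. \<forall>t. f (\<chi> i. poly (u $ i) t) * g (\<chi> i. poly (u $ i) t) = poly q t"
    by (intro exI[of _ "p * q"]) simp
qed

lemma polyfun_diff:
  assumes "polyfun f" "polyfun g"
  shows "polyfun (\<lambda>x. f x - g x)"
  using polyfun_add[OF assms(1) polyfun_mult[OF polyfun_const[of "-1"] assms(2)]] by simp

lemma polyfun_sum: "(\<And>i. i \<in> I \<Longrightarrow> polyfun (f i)) \<Longrightarrow> polyfun (\<lambda>x. \<Sum>i\<in>I. f i x)"
  by (induction I rule: infinite_finite_induct) (auto intro: polyfun_const polyfun_add)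

lemma polyfun_prod: "(\<And>i. i \<in> I \<Longrightarrow> polyfun (f i)) \<Longrightarrow> polyfun (\<lambda>x. \<Prod>i\<in>I. f i x)"
  by (induction I rule: infinite_finite_induct) (auto intro: polyfun_const polyfun_mult)

lemma polyfun_power: "polyfun f \<Longrightarrow> polyfun (\<lambda>x. f x ^ k)"
  by (induction k) (auto intro: polyfun_const polyfun_mult)

lemma polyfun_compose:
  fixes g :: "complex^'m \<Rightarrow> complex" and h :: "complex^'n \<Rightarrow> complex^'m"
  assumes "polyfun g" "\<And>i. polyfun (\<lambda>x. h x $ i)"
  shows "polyfun (\<lambda>x. g (h x))"
proof (rule polyfunI)
  fix u :: "complex poly^'n"
  have "\<forall>i. \<exists>q. \<forall>t. h (\<chi> i. poly (u $ i) t) $ i = poly q t"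
    using assms(2) unfolding polyfun_def by blast
  then obtain q where "\<And>i t. h (\<chi> i. poly (u $ i) t) $ i = poly (q i) t" by metis
  then have q: "h (\<chi> i. poly (u $ i) t) = (\<chi> i. poly ((\<chi> i. q i) $ i) t)" for t
    by (simp add: vec_eq_iff)
  show "\<exists>p. \<forall>t. g (h (\<chi> i. poly (u $ i) t)) = poly p t"
    unfolding q using assms(1) unfolding polyfun_def by blast
qed

lemmas polyfun_intros = polyfun_const polyfun_component polyfun_add polyfun_mult polyfun_diff
  polyfun_sum polyfun_prod polyfun_power

lemma polyfun_peval: "polyfun (peval \<phi> f)"
  unfolding peval_def by (intro polyfun_intros)

lemma polyfun_quad: "polyfun (quad A)"
  unfolding quad_def by (intro polyfun_intros)

lemma polyfun_polar: "polyfun (polar A x)"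
  unfolding polar_def by (intro polyfun_intros)

lemma polyfun_second_point: "polyfun (\<lambda>w. second_point A y w $ i)"
  unfolding second_point_def by (simp add: polyfun_intros polyfun_quad polyfun_polar)

lemma polyfun_finite_zeros_on_line:
  assumes g: "polyfun g" and "g (x + s *s y) \<noteq> 0"
  shows "finite {t. g (x + t *s y) = 0}"
proof -
  obtain q where "\<And>t. g (\<chi> i. poly ((\<chi> i. [:x $ i, y $ i:]) $ i) t) = poly q t"
    using g unfolding polyfun_def by metis
  moreover have "(\<chi> i. poly ((\<chi> i. [:x $ i, y $ i:]) $ i) t) = x + t *s y" for t
    by (simp add: vec_eq_iff)
  ultimately have q: "g (x + t *s y) = poly q t" for t by metis
  then have "q \<noteq> 0" using assms(2) by auto
  then show ?thesis unfolding q by (rule poly_roots_finite)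
qed

text \<open>Affine space is irreducible: a line joining a point where \<open>g\<close> does not vanish to one where
  \<open>h\<close> does not vanish contains only finitely many zeros of \<open>g\<close> and of \<open>h\<close>.\<close>

lemma polyfun_mult_nonzero:
  assumes "polyfun g" "polyfun h" "g a \<noteq> 0" "h b \<noteq> 0"
  obtains w where "g w \<noteq> 0" "h w \<noteq> 0"
proof -
  have "finite {t. g (a + t *s (b - a)) = 0}"
    by (rule polyfun_finite_zeros_on_line[OF assms(1), of _ 0]) (use assms in simp)
  moreover have "finite {t. h (a + t *s (b - a)) = 0}"
    by (rule polyfun_finite_zeros_on_line[OF assms(2), of _ 1]) (use assms in simp)
  ultimately have "\<exists>t. t \<notin> {t. g (a + t *s (b - a)) = 0} \<union> {t. h (a + t *s (b - a)) = 0}"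
    by (intro ex_new_if_finite) (auto simp: infinite_UNIV_char_0)
  then show ?thesis using that by blast
qed

text \<open>One coordinate at a time, arbitrary complex values are allowed: a polynomial in one variable
  that vanishes at all integers is zero.\<close>

lemma polyfun_integer_nonzero:
  fixes g :: "complex^'n::finite \<Rightarrow> complex"
  assumes g: "polyfun g" and x: "g x \<noteq> 0"
  obtains z :: "int^'n" where "g (of_int_vec z) \<noteq> 0"
proof (rule ccontr)
  assume "\<not> thesis"
  then have z: "g (of_int_vec z) = 0" for z :: "int^'n" using that by blast
  have "g x = 0" if "finite S" "\<forall>i. i \<notin> S \<longrightarrow> x $ i \<in> \<int>" for S and x :: "complex^'n"
    using that
  proof (induction S arbitrary: x rule: finite_induct)
    case empty
    then have "x = of_int_vec (\<chi> i. \<lfloor>Re (x $ i)\<rfloor>)"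
      by (auto simp: vec_eq_iff elim!: Ints_cases)
        (metis Re_complex_of_real empty.prems Ints_cases emptyE floor_of_int of_real_of_int_eq)
    then show ?case using z by metis
  next
    case (insert k S)
    define y where "y = (\<chi> i. if i = k then 0 else x $ i)"
    have "g (y + of_int m *s axis k 1) = 0" for m
      using insert.prems by (intro insert.IH) (auto simp: y_def axis_def)
    then have "range of_int \<subseteq> {t. g (y + t *s axis k 1) = 0}" by auto
    moreover have "infinite (range (of_int :: int \<Rightarrow> complex))"
      by (simp add: finite_image_iff inj_on_def)
    ultimately have "infinite {t. g (y + t *s axis k 1) = 0}" using finite_subset by blast
    then have "g (y + x $ k *s axis k 1) = 0"
      using polyfun_finite_zeros_on_line[OF g] by blast
    moreover have "y + x $ k *s axis k 1 = x" by (simp add: y_def axis_def vec_eq_iff)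
    ultimately show ?case by simp
  qed
  from this[of UNIV] x show False by simp
qed

text \<open>The scalar \<open>c\<close> below absorbs the choice of the coordinate vector that witnesses the
  nonvanishing of a form.\<close>

lemma zariski_open_polyfun:
  fixes x :: "complex^'n::finite"
  assumes "openin zariski U" and x: "x \<noteq> 0" "abs_proj x \<in> U"
  obtains g where "polyfun g" "g x \<noteq> 0" "\<And>y. y \<noteq> 0 \<Longrightarrow> g y \<noteq> 0 \<Longrightarrow> abs_proj y \<in> U"
proof -
  have "generate_topology_on {- zero_locus of_rat f | f :: (rat, 'n) poly_ring. \<exists>d. homogeneous d f} U"
    using assms(1) unfolding zariski_def by (rule openin_topology_generated_by)
  then have "abs_proj x \<in> U \<longrightarrow> (\<exists>g. polyfun g \<and> g x \<noteq> 0 \<and> (\<forall>y. y \<noteq> 0 \<longrightarrow> g y \<noteq> 0 \<longrightarrow> abs_proj y \<in> U))"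
  proof induction
    case Empty
    then show ?case by simp
  next
    case (Int a b)
    show ?case
    proof
      assume "abs_proj x \<in> a \<inter> b"
      then obtain g h where
        "polyfun g \<and> g x \<noteq> 0 \<and> (\<forall>y. y \<noteq> 0 \<longrightarrow> g y \<noteq> 0 \<longrightarrow> abs_proj y \<in> a)"
        "polyfun h \<and> h x \<noteq> 0 \<and> (\<forall>y. y \<noteq> 0 \<longrightarrow> h y \<noteq> 0 \<longrightarrow> abs_proj y \<in> b)"
        using Int.IH by blast
      then show "\<exists>g. polyfun g \<and> g x \<noteq> 0 \<and> (\<forall>y. y \<noteq> 0 \<longrightarrow> g y \<noteq> 0 \<longrightarrow> abs_proj y \<in> a \<inter> b)"
        by (intro exI[of _ "\<lambda>x. g x * h x"]) (simp add: polyfun_mult)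
    qed
  next
    case (UN K)
    then show ?case by blast
  next
    case (Basis s)
    then obtain f :: "(rat, 'n) poly_ring" where s: "s = - zero_locus of_rat f" by blast
    show ?case
    proof
      assume "abs_proj x \<in> s"
      then obtain x' where x': "x' \<noteq> 0" "abs_proj x = abs_proj x'" "peval of_rat f x' \<noteq> 0"
        unfolding s zero_locus_def by blast
      then obtain c where c: "c \<noteq> 0" "x' = c *s x" using x(1) by (auto simp: abs_proj_eq_iff)
      have "abs_proj y \<in> s" if "y \<noteq> 0" "peval of_rat f (c *s y) \<noteq> 0" for y :: "complex^'n"
      proof -
        have "c *s y \<noteq> 0" using c that by (simp add: vec_eq_iff)
        moreover from this have "abs_proj y = abs_proj (c *s y)"
          using c that by (auto simp: abs_proj_eq_iff)
        ultimately show ?thesis using that unfolding s zero_locus_def by blast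
      qed
      moreover have "polyfun (\<lambda>y. peval of_rat f (c *s y))"
        by (rule polyfun_compose[OF polyfun_peval]) (simp add: polyfun_intros)
      ultimately show "\<exists>g. polyfun g \<and> g x \<noteq> 0 \<and> (\<forall>y. y \<noteq> 0 \<longrightarrow> g y \<noteq> 0 \<longrightarrow> abs_proj y \<in> s)"
        using x' c by (intro exI[of _ "\<lambda>y. peval of_rat f (c *s y)"]) auto
    qed
  qed
  then show ?thesis using x that by blast
qed

text \<open>Realises a hyperplane as one of the closed sets that generate the topology.\<close>

lemma linear_form_exists:
  fixes l :: "rat^'n::finite"
  obtains f :: "(rat, 'n) poly_ring" where "homogeneous 1 f"
    "\<And>x :: complex^'n. peval of_rat f x = (\<Sum>i\<in>UNIV. of_rat (l $ i) * x $ i)"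
proof
  define e :: "'n \<Rightarrow> 'n \<Rightarrow>\<^sub>0 nat" where "e = (\<lambda>i. Poly_Mapping.single i 1)"
  define f where "f = (\<Sum>i\<in>UNIV. Poly_Mapping.single (e i) (l $ i))"
  have e: "e i = e j \<longleftrightarrow> i = j" for i j
    unfolding e_def by (metis lookup_single_eq lookup_single_not_eq one_neq_zero)
  have l: "Poly_Mapping.lookup f m = (\<Sum>i\<in>UNIV. if e i = m then l $ i else 0)" for m
    by (simp add: f_def lookup_sum lookup_single when_def)
  have le: "Poly_Mapping.lookup f (e i) = l $ i" for i
    by (simp add: l e)
  have keys: "Poly_Mapping.keys f \<subseteq> range e"
  proof
    fix m assume "m \<in> Poly_Mapping.keys f"
    then have "Poly_Mapping.lookup f m \<noteq> 0" by (simp add: in_keys_iff)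
    then obtain i where "(if e i = m then l $ i else 0) \<noteq> 0"
      unfolding l using sum.not_neutral_contains_not_neutral by blast
    then show "m \<in> range e" by (auto split: if_splits)
  qed
  then show "homogeneous 1 f"
    by (auto simp: homogeneous_def e_def lookup_single when_def)
  fix x :: "complex^'n"
  have "peval of_rat f x = (\<Sum>m\<in>range e.
     of_rat (Poly_Mapping.lookup f m) * (\<Prod>k\<in>UNIV. x $ k ^ Poly_Mapping.lookup m k))"
    unfolding peval_def using keys by (intro sum.mono_neutral_left) (auto simp: in_keys_iff)
  also have "\<dots> = (\<Sum>i\<in>UNIV. of_rat (l $ i) * (\<Prod>k\<in>UNIV. x $ k ^ Poly_Mapping.lookup (e i) k))"
    by (subst sum.reindex) (auto simp: inj_on_def e le)
  also have "\<dots> = (\<Sum>i\<in>UNIV. of_rat (l $ i) * x $ i)"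
  proof (rule sum.cong[OF refl])
    fix i
    have "(\<Prod>k\<in>UNIV. x $ k ^ Poly_Mapping.lookup (e i) k) = (\<Prod>k\<in>UNIV. if k = i then x $ k else 1)"
      by (intro prod.cong) (auto simp: e_def lookup_single when_def)
    then show "of_rat (l $ i) * (\<Prod>k\<in>UNIV. x $ k ^ Poly_Mapping.lookup (e i) k) = of_rat (l $ i) * x $ i"
      by simp
  qed
  finally show "peval of_rat f x = (\<Sum>i\<in>UNIV. of_rat (l $ i) * x $ i)" .
qed

section \<open>Absolute values, norms and heights of integer vectors\<close>

definition int_abs :: "place \<Rightarrow> int \<Rightarrow> real" where
  "int_abs v a = place_abs v (of_int a)"

lemma int_abs_Real [simp]: "int_abs Real_place a = \<bar>real_of_int a\<bar>"
  by (simp add: int_abs_def)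

lemma int_abs_nonneg [simp]: "int_abs v a \<ge> 0"
  by (simp add: int_abs_def place_abs_nonneg)

lemma int_abs_0_iff [simp]: "int_abs v a = 0 \<longleftrightarrow> a = 0"
  by (simp add: int_abs_def)

lemma int_abs_0 [simp]: "int_abs v 0 = 0"
  by simp

lemma int_abs_pos_iff [simp]: "int_abs v a > 0 \<longleftrightarrow> a \<noteq> 0"
  using int_abs_nonneg[of v a] int_abs_0_iff[of v a] by linarith

lemma int_abs_mult: "int_abs v (a * b) = int_abs v a * int_abs v b"
  by (simp add: int_abs_def place_abs_mult)

lemma int_abs_minus [simp]: "int_abs v (- a) = int_abs v a"
proof -
  have "int_abs v (-1) * int_abs v (-1) = int_abs v 1 * int_abs v 1" by (simp flip: int_abs_mult)
  then have "int_abs v (-1) = int_abs v 1"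
    by (metis int_abs_nonneg abs_of_nonneg power2_eq_square real_sqrt_abs)
  then show ?thesis by (metis int_abs_mult mult_1 mult_minus1)
qed

lemma int_abs_padic:
  assumes "a \<noteq> 0"
  shows "int_abs (Padic_place p) a =
    (1 / real (Rep_prime_number p)) ^ multiplicity (int (Rep_prime_number p)) a"
proof -
  have "prime (Rep_prime_number p)" using Rep_prime_number by blast
  from padic_abs_Fract[OF this assms, of 1] show ?thesis
    by (simp add: int_abs_def Fract_of_int_eq power_int_minus power_one_over divide_simps)
qed

lemma int_abs_padic_le_1: "int_abs (Padic_place p) a \<le> 1"
proof (cases "a = 0")
  case False
  have "prime (Rep_prime_number p)" using Rep_prime_number by blast
  then have "real (Rep_prime_number p) \<ge> 1" using prime_ge_1_nat by simp
  then show ?thesis unfolding int_abs_padic[OF False] by (intro power_le_one) auto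
qed simp

lemma int_abs_add_le: "int_abs v (a + b) \<le> int_abs v a + int_abs v b"
proof (cases v)
  case (Padic_place p)
  let ?p = "Rep_prime_number p"
  have p: "prime ?p" using Rep_prime_number by blast
  then have p1: "real ?p \<ge> 1" using prime_ge_1_nat by simp
  show ?thesis
  proof (cases "a = 0 \<or> b = 0 \<or> a + b = 0")
    case True
    then show ?thesis by auto
  next
    case False
    define k where "k = min (multiplicity (int ?p) a) (multiplicity (int ?p) b)"
    have "int ?p ^ k dvd a" "int ?p ^ k dvd b" by (simp_all add: k_def multiplicity_dvd')
    then have "int ?p ^ k dvd a + b" by simp
    then have "k \<le> multiplicity (int ?p) (a + b)"
      using False p by (intro multiplicity_geI) auto
    then have "int_abs v (a + b) \<le> (1 / real ?p) ^ k"
      using False p1 unfolding Padic_place by (simp add: int_abs_padic power_decreasing)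
    also have "\<dots> \<le> int_abs v a + int_abs v b"
      using False unfolding Padic_place by (auto simp: int_abs_padic k_def min_def)
    finally show ?thesis .
  qed
qed simp

lemma int_abs_diff_le: "int_abs v (a - b) \<le> int_abs v a + int_abs v b"
  using int_abs_add_le[of v a "- b"] by simp

lemma int_abs_sum_le: "int_abs v (sum f I) \<le> (\<Sum>i\<in>I. int_abs v (f i))"
proof (induction I rule: infinite_finite_induct)
  case (insert i I)
  then show ?case using int_abs_add_le[of v "f i" "sum f I"] by simp
qed auto

lemma int_abs_le: "int_abs v a \<le> \<bar>real_of_int a\<bar>"
proof (cases v)
  case (Padic_place p)
  then show ?thesis using int_abs_padic_le_1[of p a] by (cases "a = 0") auto
qed simp

text \<open>The trivial instance of the product formula: \<open>p\<close> cannot divide \<open>a\<close> to a power exceeding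
  \<open>\<bar>a\<bar>\<close>.\<close>

lemma int_abs_mult_abs_ge_1:
  assumes "a \<noteq> 0"
  shows "1 \<le> int_abs v a * \<bar>real_of_int a\<bar>"
proof (cases v)
  case Real_place
  have "1 \<le> \<bar>real_of_int a\<bar>" using assms by simp
  then have "1 * 1 \<le> \<bar>real_of_int a\<bar> * \<bar>real_of_int a\<bar>" by (intro mult_mono) auto
  then show ?thesis by (simp only: Real_place int_abs_Real)
next
  case (Padic_place p)
  let ?p = "Rep_prime_number p"
  have "prime ?p" using Rep_prime_number by blast
  then have p: "real ?p > 0" using prime_gt_0_nat by simp
  have "int ?p ^ multiplicity (int ?p) a \<le> \<bar>a\<bar>"
    using assms by (intro zdvd_imp_le) (simp_all add: multiplicity_dvd)
  then have "real_of_int (int ?p ^ multiplicity (int ?p) a) \<le> real_of_int \<bar>a\<bar>"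
    by (simp only: of_int_le_iff)
  then show ?thesis using p assms by (simp add: Padic_place int_abs_padic power_one_over divide_simps)
qed

definition vnorm :: "place \<Rightarrow> int^'n::finite \<Rightarrow> real" where
  "vnorm v x = Max (range (\<lambda>i. int_abs v (x $ i)))"

lemma int_abs_le_vnorm: "int_abs v (x $ i) \<le> vnorm v x"
  by (simp add: vnorm_def)

lemma vnorm_attained: obtains i where "vnorm v x = int_abs v (x $ i)"
proof -
  have "vnorm v x \<in> range (\<lambda>i. int_abs v (x $ i))" unfolding vnorm_def by (rule Max_in) auto
  then show ?thesis using that by blast
qed

lemma vnorm_nonneg: "vnorm v x \<ge> 0"
  by (metis int_abs_nonneg vnorm_attained)

lemma vnorm_pos: "x \<noteq> 0 \<Longrightarrow> vnorm v x > 0"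
proof -
  assume "x \<noteq> 0"
  then obtain i where "x $ i \<noteq> 0" by (auto simp: vec_eq_iff)
  then have "int_abs v (x $ i) > 0" by simp
  then show ?thesis using int_abs_le_vnorm less_le_trans by blast
qed

lemma vnorm_le: "(\<And>i. int_abs v (x $ i) \<le> M) \<Longrightarrow> vnorm v x \<le> M"
  by (metis vnorm_attained)

lemma vnorm_mono: "vnorm v x \<le> vnorm Real_place x"
  by (metis int_abs_le int_abs_Real int_abs_le_vnorm order_trans vnorm_le)

lemma vnorm_padic_le_1: "vnorm (Padic_place p) x \<le> 1"
  by (intro vnorm_le int_abs_padic_le_1)

lemma vnorm_scale: "vnorm v (c *s x) = int_abs v c * vnorm v x"
  by (simp add: vnorm_def int_abs_mult Max_range_scale)

definition coeff_sum :: "int^'n^'n::finite \<Rightarrow> real" where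
  "coeff_sum A = (\<Sum>i\<in>UNIV. \<Sum>j\<in>UNIV. \<bar>real_of_int (A $ i $ j)\<bar>)"

lemma coeff_sum_nonneg: "coeff_sum A \<ge> 0"
  by (simp add: coeff_sum_def sum_nonneg)

lemma int_abs_double_sum_le:
  assumes "\<And>i j. int_abs v (f i j) \<le> M"
  shows "int_abs v (\<Sum>i\<in>UNIV. \<Sum>j\<in>UNIV. A $ i $ j * f i j) \<le> coeff_sum A * M"
proof -
  have "int_abs v (A $ i $ j * f i j) \<le> \<bar>real_of_int (A $ i $ j)\<bar> * M" for i j
    unfolding int_abs_mult using assms by (intro mult_mono int_abs_le) auto
  then have "(\<Sum>i\<in>UNIV. \<Sum>j\<in>UNIV. int_abs v (A $ i $ j * f i j)) \<le> coeff_sum A * M"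
    unfolding coeff_sum_def sum_distrib_right by (intro sum_mono)
  moreover have "int_abs v (\<Sum>i\<in>UNIV. \<Sum>j\<in>UNIV. A $ i $ j * f i j) \<le> (\<Sum>i\<in>UNIV. \<Sum>j\<in>UNIV. int_abs v (A $ i $ j * f i j))"
    by (rule order_trans[OF int_abs_sum_le]) (intro sum_mono int_abs_sum_le)
  ultimately show ?thesis by linarith
qed

lemma int_abs_quad_le:
  assumes "\<And>i. int_abs v (x $ i) \<le> M"
  shows "int_abs v (quad A x) \<le> coeff_sum A * M\<^sup>2"
proof -
  have "M \<ge> 0" using order_trans[OF int_abs_nonneg assms] .
  then have "int_abs v (x $ i * x $ j) \<le> M\<^sup>2" for i j
    unfolding int_abs_mult power2_eq_square
    using assms by (intro mult_mono) auto
  from int_abs_double_sum_le[OF this] show ?thesis by (simp add: quad_def)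
qed

lemma int_abs_polar_le:
  assumes "\<And>i. int_abs v (x $ i) \<le> M" "\<And>i. int_abs v (y $ i) \<le> N"
  shows "int_abs v (polar A x y) \<le> 2 * coeff_sum A * M * N"
proof -
  have "M \<ge> 0" using order_trans[OF int_abs_nonneg assms(1)] .
  then have p: "int_abs v (x $ i * y $ j) \<le> M * N" for i j
    unfolding int_abs_mult using assms by (intro mult_mono) auto
  have "int_abs v (x $ i * y $ j + y $ i * x $ j) \<le> 2 * M * N" for i j
    using p[of i j] p[of j i] int_abs_add_le[of v "x $ i * y $ j" "x $ j * y $ i"]
    by (simp add: mult.commute[of "y $ i"] mult.assoc)
  from int_abs_double_sum_le[OF this] show ?thesis by (simp add: polar_def mult_ac)
qed

lemma clear_denominators:
  fixes x :: "rat^'n::finite"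
  obtains d :: int and z :: "int^'n" where "d \<noteq> 0" "of_int d *s x = of_int_vec z"
proof -
  define q where "q i = snd (quotient_of (x $ i))" for i
  define d where "d = (\<Prod>i\<in>UNIV. q i)"
  have q: "q i > 0" for i unfolding q_def by (metis prod.collapse quotient_of_denom_pos)
  then have "d > 0" by (simp add: d_def prod_pos)
  have "\<exists>z. of_int d * x $ i = of_int z" for i
  proof -
    have "x $ i = of_int (fst (quotient_of (x $ i))) / of_int (q i)"
      unfolding q_def by (metis prod.collapse quotient_of_div)
    moreover have "d = q i * (\<Prod>j\<in>UNIV - {i}. q j)" by (simp add: d_def prod.remove[of _ i])
    moreover have "q i \<noteq> 0" using q[of i] by simp
    ultimately have "of_int d * x $ i = of_int ((\<Prod>j\<in>UNIV - {i}. q j) * fst (quotient_of (x $ i)))"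
      by (simp add: field_simps)
    then show ?thesis by blast
  qed
  then obtain z where "\<And>i. of_int d * x $ i = of_int (z i)" by metis
  then have "of_int d *s x = of_int_vec (\<chi> i. z i)" by (simp add: vec_eq_iff)
  then show ?thesis using \<open>d > 0\<close> that[of d] by simp
qed

lemma primitive_part:
  fixes x :: "int^'n::finite"
  assumes "x \<noteq> 0"
  obtains g z where "g \<noteq> 0" "x = g *s z" "Gcd (range (($) z)) = 1"
proof -
  define g where "g = Gcd (range (($) x))"
  have g0: "g \<noteq> 0" using assms by (auto simp: g_def Gcd_0_iff vec_eq_iff)
  define z where "z = (\<chi> i. x $ i div g)"
  have "g dvd x $ i" for i by (simp add: g_def)
  then have x: "x = g *s z" by (simp add: z_def vec_eq_iff)
  then have "range (($) x) = (*) g ` range (($) z)" by (simp add: image_image)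
  then have "g = \<bar>g\<bar> * Gcd (range (($) z))"
    by (metis g_def Gcd_mult abs_Gcd_eq abs_mult normalize_int_def)
  moreover have "g \<ge> 0" by (simp add: g_def)
  ultimately have "Gcd (range (($) z)) = 1" using g0 by simp
  then show ?thesis using that g0 x by blast
qed

lemma abs_proj_scale:
  assumes "x \<noteq> 0" "c \<noteq> 0"
  shows "abs_proj (c *s x) = abs_proj x"
proof -
  have "c *s x \<noteq> 0" using assms by (simp add: vec_eq_iff)
  then have "abs_proj x = abs_proj (c *s x)" using assms by (auto simp: abs_proj_eq_iff)
  then show ?thesis by simp
qed

lemma primitive_nonzero: "Gcd (range (($) z)) = (1::int) \<Longrightarrow> z \<noteq> 0"
proof
  assume "Gcd (range (($) z)) = 1" "z = 0"
  then have "Gcd (range (($) z)) = 0" by (auto simp: Gcd_0_iff)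
  with \<open>Gcd (range (($) z)) = 1\<close> show False by simp
qed

lemma primitive_coordinates:
  fixes P :: "(rat, 'n::finite) proj"
  obtains z :: "int^'n" where "Gcd (range (($) z)) = 1" "P = abs_proj (of_int_vec z)"
proof -
  obtain x where x: "x \<noteq> 0" "P = abs_proj x" by (rule abs_proj_cases)
  obtain d z where d: "d \<noteq> 0" "of_int d *s x = of_int_vec z" by (rule clear_denominators)
  have P: "P = abs_proj (of_int_vec z)"
    using x d abs_proj_scale[of x "of_int d"] by simp
  have "of_int_vec z \<noteq> (0 :: rat^'n)" using x d unfolding d(2)[symmetric] by (simp add: vec_eq_iff)
  then have "z \<noteq> 0" by simp
  then obtain g w where g: "g \<noteq> 0" "z = g *s w" "Gcd (range (($) w)) = 1" by (rule primitive_part)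
  then have "P = abs_proj (of_int_vec w)"
    unfolding P g(2) of_int_vec_hom using primitive_nonzero[OF g(3)] by (simp add: abs_proj_scale)
  then show ?thesis using that g by blast
qed

lemma height_of_primitive:
  "Gcd (range (($) z)) = 1 \<Longrightarrow> height (abs_proj (of_int_vec z)) = vnorm Real_place z"
  using height_primitive[of z] by (simp add: of_int_vec_def vnorm_def)

lemma height_le_vnorm:
  assumes "x \<noteq> 0"
  shows "height (abs_proj (of_int_vec x)) \<le> vnorm Real_place x"
proof -
  obtain g z where g: "g \<noteq> 0" "x = g *s z" "Gcd (range (($) z)) = 1"
    using primitive_part[OF assms] .
  have "height (abs_proj (of_int_vec x)) = vnorm Real_place z"
    unfolding g(2) of_int_vec_hom using g(1) primitive_nonzero[OF g(3)]
    by (simp add: abs_proj_scale height_of_primitive[OF g(3)])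
  also have "\<dots> \<le> \<bar>real_of_int g\<bar> * vnorm Real_place z"
    using g(1) mult_right_mono[of 1 "\<bar>real_of_int g\<bar>" "vnorm Real_place z"] vnorm_nonneg[of Real_place z] by simp
  also have "\<dots> = vnorm Real_place x" unfolding g(2) vnorm_scale by simp
  finally show ?thesis by simp
qed

lemma height_pos: "height P > 0"
proof -
  obtain z where "Gcd (range (($) z)) = 1" "P = abs_proj (of_int_vec z)" by (rule primitive_coordinates)
  then show ?thesis using height_of_primitive primitive_nonzero vnorm_pos by metis
qed

lemma finite_bounded_height: "finite {P :: (rat, 'n::finite) proj. height P \<le> M}"
proof -
  have "finite {z :: int^'n. \<forall>i. z $ i \<in> {-\<lceil>M\<rceil>..\<lceil>M\<rceil>}}"
  proof (rule finite_subset)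
    show "{z :: int^'n. \<forall>i. z $ i \<in> {-\<lceil>M\<rceil>..\<lceil>M\<rceil>}} \<subseteq> vec_lambda ` (Pi\<^sub>E UNIV (\<lambda>_. {-\<lceil>M\<rceil>..\<lceil>M\<rceil>}))"
    proof
      fix z :: "int^'n" assume "z \<in> {z. \<forall>i. z $ i \<in> {-\<lceil>M\<rceil>..\<lceil>M\<rceil>}}"
      then have "z = vec_lambda (($) z)" "($) z \<in> Pi\<^sub>E UNIV (\<lambda>_. {-\<lceil>M\<rceil>..\<lceil>M\<rceil>})"
        by (auto simp: PiE_def)
      then show "z \<in> vec_lambda ` (Pi\<^sub>E UNIV (\<lambda>_. {-\<lceil>M\<rceil>..\<lceil>M\<rceil>}))" by blast
    qed
    show "finite (vec_lambda ` (Pi\<^sub>E (UNIV :: 'n set) (\<lambda>_. {-\<lceil>M\<rceil>..\<lceil>M\<rceil>})))"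
      by (intro finite_imageI finite_PiE) auto
  qed
  moreover have "{P. height P \<le> M} \<subseteq> (\<lambda>z. abs_proj (of_int_vec z)) `
      {z :: int^'n. \<forall>i. z $ i \<in> {-\<lceil>M\<rceil>..\<lceil>M\<rceil>}}"
  proof
    fix P :: "(rat, 'n) proj" assume P: "P \<in> {P. height P \<le> M}"
    obtain z where z: "Gcd (range (($) z)) = 1" "P = abs_proj (of_int_vec z)"
      by (rule primitive_coordinates)
    have "z $ i \<in> {-\<lceil>M\<rceil>..\<lceil>M\<rceil>}" for i
    proof -
      have "\<bar>real_of_int (z $ i)\<bar> \<le> M"
        using P z height_of_primitive int_abs_le_vnorm[of Real_place z i] by fastforce
      then show ?thesis by (simp add: abs_le_iff) linarith
    qed
    then show "P \<in> (\<lambda>z. abs_proj (of_int_vec z)) ` {z. \<forall>i. z $ i \<in> {-\<lceil>M\<rceil>..\<lceil>M\<rceil>}}"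
      using z(2) by blast
  qed
  ultimately show ?thesis using finite_subset by blast
qed

lemma proj_dist_of_int_vec:
  fixes x y :: "int^'n::finite"
  assumes "x \<noteq> 0" "y \<noteq> 0"
  shows "proj_dist v (abs_proj (of_int_vec x)) (abs_proj (of_int_vec y)) =
    Max (range (\<lambda>(i, j). int_abs v (x $ i * y $ j - x $ j * y $ i))) / (vnorm v x * vnorm v y)"
proof -
  have "projrel (of_int_vec x :: rat^'n) (of_int_vec x)" "projrel (of_int_vec y :: rat^'n) (of_int_vec y)"
    using assms by (simp_all add: projrel_refl)
  from proj_dist.abs_eq[OF this, of v] show ?thesis
    by (simp add: vnorm_def int_abs_def)
qed

lemma minor_le_proj_dist:
  assumes "x \<noteq> 0" "y \<noteq> 0"
  shows "int_abs v (x $ i * y $ j - x $ j * y $ i) \<le>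
    proj_dist v (abs_proj (of_int_vec x)) (abs_proj (of_int_vec y)) * (vnorm v x * vnorm v y)"
proof -
  have "int_abs v (x $ i * y $ j - x $ j * y $ i) \<le>
      Max (range (\<lambda>(i, j). int_abs v (x $ i * y $ j - x $ j * y $ i)))"
    by (rule Max_ge) (auto intro: range_eqI[of _ _ "(i, j)"])
  then show ?thesis
    using assms vnorm_pos[of x v] vnorm_pos[of y v] by (simp add: proj_dist_of_int_vec)
qed

lemma proj_dist_nonneg:
  "proj_dist v P Q \<ge> 0"
proof -
  obtain x where x: "Gcd (range (($) x)) = 1" "P = abs_proj (of_int_vec x)" by (rule primitive_coordinates)
  obtain y where y: "Gcd (range (($) y)) = 1" "Q = abs_proj (of_int_vec y)" by (rule primitive_coordinates)
  have "0 \<le> proj_dist v P Q * (vnorm v x * vnorm v y)"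
    using minor_le_proj_dist[OF x(1)[THEN primitive_nonzero] y(1)[THEN primitive_nonzero]]
      int_abs_nonneg order_trans unfolding x(2) y(2) by blast
  moreover have "vnorm v x * vnorm v y > 0"
    using x y by (simp add: primitive_nonzero vnorm_pos)
  ultimately show ?thesis by (simp add: zero_le_mult_iff)
qed

lemma proj_dist_le:
  assumes "x \<noteq> 0" "y \<noteq> 0" "\<And>i j. int_abs v (x $ i * y $ j - x $ j * y $ i) \<le> M"
  shows "proj_dist v (abs_proj (of_int_vec x)) (abs_proj (of_int_vec y)) \<le> M / (vnorm v x * vnorm v y)"
proof -
  have "Max (range (\<lambda>(i, j). int_abs v (x $ i * y $ j - x $ j * y $ i))) \<le> M"
    using assms(3) by (subst Max_le_iff) auto
  then show ?thesis unfolding proj_dist_of_int_vec[OF assms(1,2)]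
    by (intro divide_right_mono mult_nonneg_nonneg vnorm_nonneg)
qed

section \<open>Points off the tangent hyperplane keep their distance\<close>

text \<open>On the quadric the polar form is of second order in the distance. The vector
  \<open>u = y\<^sub>l x - x\<^sub>l y\<close> consists of minors and satisfies \<open>F(u) = - x\<^sub>l y\<^sub>l \<langle>x, y\<rangle>\<close>; taking
  \<open>\<bar>y\<^sub>l\<bar>\<close> maximal, this gives the bound unless \<open>\<bar>x\<^sub>l\<bar>\<close> is small compared with the norm of \<open>x\<close>. In
  that case the points are at distance at least \<open>1/2\<close> and the trivial bound is enough.\<close>

lemma int_abs_polar_le_proj_dist:
  fixes x y :: "int^'n::finite" and v :: place
  assumes x: "x \<noteq> 0" "quad A x = 0" and y: "y \<noteq> 0" "quad A y = 0"
  defines "d \<equiv> proj_dist v (abs_proj (of_int_vec x)) (abs_proj (of_int_vec y))"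
  shows "int_abs v (polar A x y) \<le> 8 * coeff_sum A * d\<^sup>2 * (vnorm v x * vnorm v y)"
proof -
  let ?C = "coeff_sum A" and ?b = "int_abs v (polar A x y)"
  define X where "X = vnorm v x"
  define Y where "Y = vnorm v y"
  have pos: "X > 0" "Y > 0" using x y by (simp_all add: X_def Y_def vnorm_pos)
  have minor: "int_abs v (x $ i * y $ j - x $ j * y $ i) \<le> d * (X * Y)" for i j
    unfolding d_def X_def Y_def using x(1) y(1) by (rule minor_le_proj_dist)
  obtain l where l: "Y = int_abs v (y $ l)" unfolding Y_def by (rule vnorm_attained)
  obtain k where k: "X = int_abs v (x $ k)" unfolding X_def by (rule vnorm_attained)
  show ?thesis
  proof (cases "int_abs v (x $ l) \<ge> X / 2")
    case True
    define u where "u = y $ l *s x - x $ l *s y"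
    have "quad A u = - (y $ l * x $ l * polar A x y)"
      by (simp add: u_def quad_diff quad_scale polar_scale_left polar_scale_right x y)
    then have "int_abs v (quad A u) = Y * int_abs v (x $ l) * ?b"
      by (simp add: int_abs_mult l)
    moreover have "int_abs v (quad A u) \<le> ?C * (d * (X * Y))\<^sup>2"
      by (rule int_abs_quad_le) (use minor[of _ l] in \<open>simp add: u_def mult.commute\<close>)
    moreover have "Y * (X / 2) * ?b \<le> Y * int_abs v (x $ l) * ?b"
      using True pos by (intro mult_right_mono mult_left_mono) auto
    ultimately have "Y * (X / 2) * ?b \<le> ?C * (d * (X * Y))\<^sup>2" by linarith
    also have "\<dots> = (Y * (X / 2)) * (2 * ?C * d\<^sup>2 * (X * Y))"
      by (simp add: power2_eq_square)
    finally have "?b \<le> 2 * ?C * d\<^sup>2 * (X * Y)" using pos by (simp add: mult_le_cancel_left)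
    also have "\<dots> \<le> 8 * ?C * d\<^sup>2 * (X * Y)"
      using pos coeff_sum_nonneg[of A] by (intro mult_right_mono) auto
    finally show ?thesis by (simp add: X_def Y_def)
  next
    case False
    have "Y * X = int_abs v ((x $ k * y $ l - x $ l * y $ k) + x $ l * y $ k)"
      by (simp add: k l int_abs_mult)
    also have "\<dots> \<le> d * (X * Y) + int_abs v (x $ l) * int_abs v (y $ k)"
      using minor[of k l] int_abs_add_le[of v "x $ k * y $ l - x $ l * y $ k" "x $ l * y $ k"]
      by (simp add: int_abs_mult)
    also have "int_abs v (x $ l) * int_abs v (y $ k) \<le> X / 2 * Y"
      using False int_abs_le_vnorm[of v y k] pos by (intro mult_mono) (auto simp: Y_def)
    finally have "(1 / 2) * (X * Y) \<le> d * (X * Y)" by (simp add: mult.commute[of Y X])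
    then have "1 / 2 \<le> d" using pos by (simp add: mult_le_cancel_right)
    then have "(1 / 2)\<^sup>2 \<le> d\<^sup>2" by (intro power_mono) auto
    then have d: "1 \<le> 4 * d\<^sup>2" by (simp add: power2_eq_square)
    have "?b \<le> 2 * ?C * X * Y"
      unfolding X_def Y_def by (intro int_abs_polar_le int_abs_le_vnorm)
    also have "\<dots> = 2 * ?C * (X * Y) * 1" by simp
    also have "\<dots> \<le> 2 * ?C * (X * Y) * (4 * d\<^sup>2)"
      using d pos coeff_sum_nonneg[of A] by (intro mult_left_mono) auto
    finally show ?thesis by (simp add: X_def Y_def mult_ac)
  qed
qed

text \<open>A nonzero integer has absolute value at least \<open>1\<close> at the real place; at a prime its value is
  bounded below by the inverse of its size, which is bounded by the product of the real norms of \<open>x\<close>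
  and \<open>y\<close>. The norms on the left are these real norms in the first case and at most \<open>1\<close> in the
  second, so both cases take the same form.\<close>

lemma vnorm_mult_le:
  fixes x y :: "int^'n::finite"
  assumes b: "polar A x y \<noteq> 0"
  shows "vnorm v x * vnorm v y \<le>
    (2 * coeff_sum A + 1) * (vnorm Real_place x * vnorm Real_place y) * int_abs v (polar A x y)"
proof -
  let ?C = "coeff_sum A" and ?b = "int_abs v (polar A x y)"
  let ?XY = "vnorm Real_place x * vnorm Real_place y"
  have nn: "?XY \<ge> 0" by (simp add: vnorm_nonneg)
  show ?thesis
  proof (cases v)
    case Real_place
    have "?b \<ge> 1" using b by (simp add: Real_place)
    then have "1 * 1 \<le> (2 * ?C + 1) * ?b"
      using coeff_sum_nonneg[of A] by (intro mult_mono) auto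
    then have "?XY * 1 \<le> ?XY * ((2 * ?C + 1) * ?b)"
      using nn by (intro mult_left_mono) auto
    then show ?thesis by (simp add: Real_place mult_ac)
  next
    case (Padic_place p)
    have "vnorm v x * vnorm v y \<le> 1 * 1"
      unfolding Padic_place by (intro mult_mono vnorm_padic_le_1 vnorm_nonneg) auto
    also have "\<dots> \<le> ?b * \<bar>real_of_int (polar A x y)\<bar>" using int_abs_mult_abs_ge_1[OF b] by simp
    also have "\<dots> \<le> ?b * (2 * ?C * vnorm Real_place x * vnorm Real_place y)"
      using int_abs_polar_le[of Real_place x _ y _ A, OF int_abs_le_vnorm int_abs_le_vnorm]
      by (intro mult_left_mono) auto
    also have "\<dots> \<le> ?b * (2 * ?C * ?XY + ?XY)"
      using nn by (intro mult_left_mono) (auto simp: mult_ac)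
    finally show ?thesis by (simp add: algebra_simps)
  qed
qed

text \<open>The two preceding bounds combine after cancelling the norms; integer coordinates are first
  made primitive, as their size is then the height.\<close>

lemma height_mult_dist_square_ge:
  fixes y :: "int^'n::finite"
  assumes y: "y \<noteq> 0" "quad A y = 0"
  obtains K where "K > 0"
    "\<And>x. x \<noteq> 0 \<Longrightarrow> quad A x = 0 \<Longrightarrow> polar A y x \<noteq> 0 \<Longrightarrow>
      1 \<le> K * height (abs_proj (of_int_vec x)) *
        (proj_dist v (abs_proj (of_int_vec x)) (abs_proj (of_int_vec y)))\<^sup>2"
proof -
  let ?C = "coeff_sum A"
  let ?Q = "abs_proj (of_int_vec y)"
  define K where "K = (2 * ?C + 1) * (8 * ?C) * vnorm Real_place y + 1"
  have K: "K > 0"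
    using coeff_sum_nonneg[of A] vnorm_nonneg[of Real_place y] by (simp add: K_def add_nonneg_pos)
  have prim: "1 \<le> K * vnorm Real_place x * (proj_dist v (abs_proj (of_int_vec x)) ?Q)\<^sup>2"
    if x: "x \<noteq> 0" "quad A x = 0" "polar A y x \<noteq> 0" for x
  proof -
    let ?d = "proj_dist v (abs_proj (of_int_vec x)) ?Q"
    let ?N = "vnorm v x * vnorm v y"
    have N: "?N > 0" using x y by (simp add: vnorm_pos)
    have b: "polar A x y \<noteq> 0" using x by (simp add: polar_commute)
    have "1 * ?N \<le> (2 * ?C + 1) * (vnorm Real_place x * vnorm Real_place y) * int_abs v (polar A x y)"
      using vnorm_mult_le[OF b, of v] by simp
    also have "\<dots> \<le> (2 * ?C + 1) * (vnorm Real_place x * vnorm Real_place y) * (8 * ?C * ?d\<^sup>2 * ?N)"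
      using coeff_sum_nonneg[of A] by (intro mult_left_mono int_abs_polar_le_proj_dist x y)
        (auto simp: vnorm_nonneg)
    also have "\<dots> = ((K - 1) * vnorm Real_place x * ?d\<^sup>2) * ?N"
      by (simp add: K_def)
    finally have "1 \<le> (K - 1) * vnorm Real_place x * ?d\<^sup>2"
      using N mult_le_cancel_right_pos by blast
    also have "\<dots> \<le> K * vnorm Real_place x * ?d\<^sup>2"
      by (intro mult_right_mono) (auto simp: vnorm_nonneg)
    finally show ?thesis .
  qed
  show ?thesis
  proof (rule that[OF K])
    fix x :: "int^'n"
    assume x: "x \<noteq> 0" "quad A x = 0" "polar A y x \<noteq> 0"
    obtain g z where g: "g \<noteq> 0" "x = g *s z" "Gcd (range (($) z)) = 1"
      using primitive_part[OF x(1)] .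
    have z: "z \<noteq> 0" using g(3) by (rule primitive_nonzero)
    have P: "(abs_proj (of_int_vec x) :: (rat, 'n) proj) = abs_proj (of_int_vec z)"
      unfolding g(2) of_int_vec_hom using g(1) z by (simp add: abs_proj_scale)
    have "quad A z = 0" "polar A y z \<noteq> 0"
      using x g by (auto simp: quad_scale polar_scale_right)
    from prim[OF z this] show "1 \<le> K * height (abs_proj (of_int_vec x)) *
        (proj_dist v (abs_proj (of_int_vec x)) ?Q)\<^sup>2"
      unfolding P by (simp add: height_of_primitive[OF g(3)])
  qed
qed

section \<open>Good approximations on a conic\<close>

text \<open>The coordinates of \<open>X\<close> are quadratic forms in \<open>s\<close> and \<open>t\<close>, hence \<open>O(N\<^sup>2)\<close>. As \<open>w\<^sub>0\<close> is tangent
  at \<open>y\<close>, \<open>X = F(w) y - t \<langle>y, w\<^sub>1\<rangle> w\<close> with \<open>w = s w\<^sub>0 + t w\<^sub>1\<close>, so the minors of \<open>X\<close> and \<open>y\<close> carry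
  the factor \<open>t\<close>, of value at most \<open>\<bar>s\<bar>\<^sub>v / N\<close>, while the norm of \<open>X\<close> is for large \<open>N\<close> of the exact order of its leading term
  \<open>s\<^sup>2 F(w\<^sub>0) y\<close>.\<close>

lemma conic_approximation:
  fixes y w0 w1 :: "int^'n::finite"
  assumes y: "y \<noteq> 0" "quad A y = 0" and w0: "polar A y w0 = 0" "quad A w0 \<noteq> 0"
  defines "X \<equiv> \<lambda>s t. second_point A y (s *s w0 + t *s w1)"
  obtains K N0 where "K > 0" "N0 > 0"
    "\<And>N s t. N \<ge> N0 \<Longrightarrow> s \<noteq> 0 \<Longrightarrow> \<bar>real_of_int s\<bar> \<le> N \<Longrightarrow> \<bar>real_of_int t\<bar> \<le> N \<Longrightarrow>
      N * int_abs v t \<le> int_abs v s \<Longrightarrow>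
      X s t \<noteq> 0 \<and> vnorm Real_place (X s t) \<le> K * N\<^sup>2 \<and>
      proj_dist v (abs_proj (of_int_vec (X s t))) (abs_proj (of_int_vec y)) \<le> K / N"
proof -
  let ?C = "coeff_sum A"
  define W where "W = vnorm Real_place y + vnorm Real_place w0 + vnorm Real_place w1"
  have W0: "vnorm Real_place y \<le> W" "vnorm Real_place w0 \<le> W" "vnorm Real_place w1 \<le> W"
    unfolding W_def using vnorm_nonneg[of Real_place] by (smt (verit))+
  have W: "int_abs u (y $ i) \<le> W" "int_abs u (w0 $ i) \<le> W" "int_abs u (w1 $ i) \<le> W" for u i
    using W0 vnorm_mono[of u] int_abs_le_vnorm[of u] by (meson order_trans)+
  have Wpos: "W > 0" using W0(1) vnorm_pos[OF y(1), of Real_place] by linarith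
  have w_le: "int_abs u ((s *s w0 + t *s w1) $ i) \<le> (int_abs u s + int_abs u t) * W" for u s t i
  proof -
    have "int_abs u ((s *s w0 + t *s w1) $ i) \<le> int_abs u s * int_abs u (w0 $ i) + int_abs u t * int_abs u (w1 $ i)"
      using int_abs_add_le[of u "s * w0 $ i" "t * w1 $ i"] by (simp add: int_abs_mult)
    also have "\<dots> \<le> int_abs u s * W + int_abs u t * W"
      by (intro add_mono mult_left_mono W) auto
    finally show ?thesis by (simp add: algebra_simps)
  qed
  define \<beta> where "\<beta> = polar A y w1"
  define q0 where "q0 = quad A w0"
  define q1 where "q1 = quad A w1"
  define b where "b = polar A w0 w1"
  have polar_w: "polar A y (s *s w0 + t *s w1) = t * \<beta>" for s t
    by (simp add: polar_add_right polar_scale_right w0 \<beta>_def)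
  have quad_w: "quad A (s *s w0 + t *s w1) = s\<^sup>2 * q0 + (s * t * b + t\<^sup>2 * q1)" for s t
    by (simp add: quad_add quad_scale polar_scale_right polar_scale_left q0_def q1_def b_def)
  obtain k where k: "vnorm v y = int_abs v (y $ k)" by (rule vnorm_attained)
  define \<kappa> where "\<kappa> = int_abs v q0 * vnorm v y"
  have \<kappa>: "\<kappa> > 0" using w0 y by (simp add: \<kappa>_def q0_def vnorm_pos)
  define E where "E = (int_abs v b + int_abs v q1 + 2 * int_abs v \<beta>) * W"
  have E: "E \<ge> 0" using Wpos by (simp add: E_def)
  define D where "D = 8 * int_abs v \<beta> * W\<^sup>2 / (\<kappa> * vnorm v y)"
  have D: "D \<ge> 0" using \<kappa> vnorm_nonneg[of v y] by (simp add: D_def)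
  define H where "H = 12 * ?C * W ^ 3"
  define N0 where "N0 = 1 + 2 * E / \<kappa>"
  have N0: "N0 \<ge> 1" using E \<kappa> by (simp add: N0_def)
  show ?thesis
  proof (rule that[of "D + H + 1" N0])
    have H: "H \<ge> 0" using Wpos coeff_sum_nonneg[of A] by (simp add: H_def)
    show "D + H + 1 > 0" using D H by simp
    show "N0 > 0" using N0 by simp
    fix N s t
    assume N: "N \<ge> N0" and s: "s \<noteq> 0" and sN: "\<bar>real_of_int s\<bar> \<le> N" and tN: "\<bar>real_of_int t\<bar> \<le> N"
      and ts: "N * int_abs v t \<le> int_abs v s"
    have N1: "N \<ge> 1" using N N0 by linarith
    define w where "w = s *s w0 + t *s w1"
    define \<sigma> where "\<sigma> = int_abs v s"
    define \<tau> where "\<tau> = int_abs v t"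
    have \<sigma>: "\<sigma> > 0" using s by (simp add: \<sigma>_def)
    have \<tau>: "\<tau> \<ge> 0" "N * \<tau> \<le> \<sigma>" using ts by (simp_all add: \<tau>_def \<sigma>_def)
    have \<tau>\<sigma>: "\<tau> \<le> \<sigma> / N" using \<tau> N1 by (simp add: field_simps)
    have "\<sigma> / N \<le> \<sigma>" using N1 \<sigma> by (simp add: field_simps)
    then have \<tau>1: "\<tau> \<le> \<sigma>" using \<tau>\<sigma> by linarith
    have \<sigma>\<tau>: "\<sigma> * \<tau> \<le> \<sigma>\<^sup>2 / N" 
      using mult_left_mono[OF \<tau>\<sigma>, of \<sigma>] \<sigma> by (simp add: power2_eq_square)
    have \<tau>\<tau>: "\<tau>\<^sup>2 \<le> \<sigma>\<^sup>2 / N"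
      using mult_right_mono[OF \<tau>1 \<tau>(1)] \<sigma>\<tau> by (simp add: power2_eq_square)
    have X: "X s t = quad A w *s y - (t * \<beta>) *s w"
      by (simp add: X_def second_point_def w_def polar_w)
    have wv: "int_abs v (w $ i) \<le> 2 * \<sigma> * W" for i
    proof -
      have "int_abs v (w $ i) \<le> (\<sigma> + \<tau>) * W" unfolding w_def \<sigma>_def \<tau>_def by (rule w_le)
      also have "\<dots> \<le> 2 * \<sigma> * W" using \<tau>1 Wpos by (intro mult_right_mono) auto
      finally show ?thesis .
    qed
    have small: "int_abs v (t * \<beta> * a) \<le> \<sigma>\<^sup>2 / N * (int_abs v \<beta> * c)" if "int_abs v a \<le> \<sigma> * c" "c \<ge> 0" for a c
    proof -
      have "int_abs v (t * \<beta> * a) \<le> \<tau> * int_abs v \<beta> * (\<sigma> * c)"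
        unfolding int_abs_mult \<tau>_def using that(1) by (intro mult_left_mono) auto
      also have "\<dots> = (\<sigma> * \<tau>) * (int_abs v \<beta> * c)" by simp
      also have "\<dots> \<le> \<sigma>\<^sup>2 / N * (int_abs v \<beta> * c)"
        using that by (intro mult_right_mono \<sigma>\<tau>) auto
      finally show ?thesis .
    qed
    \<comment> \<open>Since \<open>F(w\<^sub>0) \<noteq> 0\<close>, the term of degree 2 in \<open>s\<close> dominates at the place \<open>v\<close>;
        \<open>N0\<close> makes the other terms at most half of it.\<close>
    have "s\<^sup>2 * q0 * y $ k = X s t $ k - (s * t * b + t\<^sup>2 * q1) * y $ k + t * \<beta> * w $ k"
      unfolding X by (simp add: w_def quad_w algebra_simps)
    then have "int_abs v (s\<^sup>2 * q0 * y $ k) \<le>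
      int_abs v (X s t $ k) + int_abs v ((s * t * b + t\<^sup>2 * q1) * y $ k) + int_abs v (t * \<beta> * w $ k)"
      using int_abs_add_le[of v "X s t $ k - (s * t * b + t\<^sup>2 * q1) * y $ k" "t * \<beta> * w $ k"]
        int_abs_diff_le[of v "X s t $ k" "(s * t * b + t\<^sup>2 * q1) * y $ k"] by simp
    moreover have "int_abs v ((s * t * b + t\<^sup>2 * q1) * y $ k) \<le> \<sigma>\<^sup>2 / N * ((int_abs v b + int_abs v q1) * W)"
    proof -
      have "int_abs v (s * t * b + t\<^sup>2 * q1) \<le> (\<sigma> * \<tau>) * int_abs v b + \<tau>\<^sup>2 * int_abs v q1"
        using int_abs_add_le[of v "s * t * b" "t\<^sup>2 * q1"]
        by (simp add: int_abs_mult power2_eq_square \<sigma>_def \<tau>_def)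
      also have "\<dots> \<le> \<sigma>\<^sup>2 / N * int_abs v b + \<sigma>\<^sup>2 / N * int_abs v q1"
        by (intro add_mono mult_right_mono \<sigma>\<tau> \<tau>\<tau>) auto
      finally have "int_abs v (s * t * b + t\<^sup>2 * q1) * int_abs v (y $ k) \<le>
          (\<sigma>\<^sup>2 / N * int_abs v b + \<sigma>\<^sup>2 / N * int_abs v q1) * W"
        using N1 by (intro mult_mono W) auto
      also have "\<dots> = \<sigma>\<^sup>2 / N * ((int_abs v b + int_abs v q1) * W)"
        by (simp only: distrib_left distrib_right mult.assoc)
      finally show ?thesis by (simp only: int_abs_mult)
    qed
    moreover have "int_abs v (t * \<beta> * w $ k) \<le> \<sigma>\<^sup>2 / N * (int_abs v \<beta> * (2 * W))"
      using wv[of k] Wpos by (intro small) (auto simp: mult_ac)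
    moreover have "int_abs v (s\<^sup>2 * q0 * y $ k) = \<sigma>\<^sup>2 * \<kappa>"
      by (simp add: int_abs_mult power2_eq_square \<kappa>_def \<sigma>_def k)
    ultimately have "\<sigma>\<^sup>2 * \<kappa> \<le> int_abs v (X s t $ k) + (\<sigma>\<^sup>2 / N * ((int_abs v b + int_abs v q1) * W) +
       \<sigma>\<^sup>2 / N * (int_abs v \<beta> * (2 * W)))" by linarith
    also have "\<sigma>\<^sup>2 / N * ((int_abs v b + int_abs v q1) * W) + \<sigma>\<^sup>2 / N * (int_abs v \<beta> * (2 * W))
       = \<sigma>\<^sup>2 * (E / N)" by (simp add: E_def algebra_simps add_divide_distrib)
    also have "\<sigma>\<^sup>2 * (E / N) \<le> \<sigma>\<^sup>2 * (\<kappa> / 2)"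
    proof (intro mult_left_mono)
      have "2 * E / \<kappa> \<le> N" using N by (simp add: N0_def)
      then show "E / N \<le> \<kappa> / 2" using \<kappa> N1 by (simp add: field_simps)
    qed simp
    finally have "\<sigma>\<^sup>2 * (\<kappa> / 2) \<le> int_abs v (X s t $ k)" by simp
    then have big: "\<sigma>\<^sup>2 * (\<kappa> / 2) \<le> vnorm v (X s t)"
      using int_abs_le_vnorm order_trans by blast
    have "0 < \<sigma>\<^sup>2 * (\<kappa> / 2)" using \<sigma> \<kappa> by simp
    then have Xpos: "vnorm v (X s t) > 0" using big by linarith
    then have X0: "X s t \<noteq> 0" by (auto simp: vnorm_def)
    have minor: "int_abs v (X s t $ i * y $ j - X s t $ j * y $ i) \<le> \<sigma>\<^sup>2 / N * (int_abs v \<beta> * (4 * W\<^sup>2))" for i j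
    proof -
      have "int_abs v (w $ i * y $ j) \<le> 2 * \<sigma> * W * W" for i j
        unfolding int_abs_mult using \<sigma> Wpos by (intro mult_mono wv W) auto
      from this[of i j] this[of j i] have "int_abs v (w $ i * y $ j - w $ j * y $ i) \<le> \<sigma> * (4 * W\<^sup>2)"
        using int_abs_diff_le[of v "w $ i * y $ j" "w $ j * y $ i"] by (simp add: power2_eq_square)
      then have "int_abs v (t * \<beta> * (w $ i * y $ j - w $ j * y $ i)) \<le> \<sigma>\<^sup>2 / N * (int_abs v \<beta> * (4 * W\<^sup>2))"
        by (rule small) simp
      moreover have "X s t $ i * y $ j - X s t $ j * y $ i = - (t * \<beta> * (w $ i * y $ j - w $ j * y $ i))"
        unfolding X by (simp add: algebra_simps)
      ultimately show ?thesis by simp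
    qed
    have ypos: "vnorm v y > 0" using y by (simp add: vnorm_pos)
    have "proj_dist v (abs_proj (of_int_vec (X s t))) (abs_proj (of_int_vec y)) \<le>
       (\<sigma>\<^sup>2 / N * (int_abs v \<beta> * (4 * W\<^sup>2))) / (vnorm v (X s t) * vnorm v y)"
      by (rule proj_dist_le[OF X0 y(1) minor])
    also have "\<dots> \<le> (\<sigma>\<^sup>2 / N * (int_abs v \<beta> * (4 * W\<^sup>2))) / (\<sigma>\<^sup>2 * (\<kappa> / 2) * vnorm v y)"
      using big Xpos ypos N1 \<sigma> \<kappa> by (intro divide_left_mono mult_right_mono mult_pos_pos) auto
    also have "\<dots> = D / N" using \<sigma> N1 \<kappa> ypos by (simp add: D_def field_simps)
    also have "\<dots> \<le> (D + H + 1) / N" using H N1 by (intro divide_right_mono) auto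
    finally have dist: "proj_dist v (abs_proj (of_int_vec (X s t))) (abs_proj (of_int_vec y)) \<le> (D + H + 1) / N" .
    have wR: "int_abs Real_place (w $ i) \<le> 2 * N * W" for i
    proof -
      have "int_abs Real_place (w $ i) \<le> (\<bar>real_of_int s\<bar> + \<bar>real_of_int t\<bar>) * W"
        using w_le[of Real_place s t i] by (simp add: w_def)
      also have "\<dots> \<le> 2 * N * W" using sN tN Wpos by (intro mult_right_mono) auto
      finally show ?thesis .
    qed
    have "int_abs Real_place (X s t $ i) \<le> H * N\<^sup>2" for i
    proof -
      have "int_abs Real_place (X s t $ i) \<le> int_abs Real_place (quad A w) * int_abs Real_place (y $ i) +
          int_abs Real_place (polar A y w) * int_abs Real_place (w $ i)"
        using int_abs_diff_le[of Real_place "quad A w * y $ i" "polar A y w * w $ i"]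
        by (simp only: X_def second_point_def w_def vector_minus_component vector_smult_component int_abs_mult)
      also have "\<dots> \<le> ?C * (2 * N * W)\<^sup>2 * W + 2 * ?C * W * (2 * N * W) * (2 * N * W)"
        using Wpos N1 coeff_sum_nonneg[of A]
        by (intro add_mono mult_mono int_abs_quad_le int_abs_polar_le wR W) auto
      also have "\<dots> = H * N\<^sup>2" by (simp add: H_def power2_eq_square power3_eq_cube)
      finally show ?thesis .
    qed
    then have "vnorm Real_place (X s t) \<le> H * N\<^sup>2" by (rule vnorm_le)
    also have "\<dots> \<le> (D + H + 1) * N\<^sup>2" using D by (intro mult_right_mono) auto
    finally show "X s t \<noteq> 0 \<and> vnorm Real_place (X s t) \<le> (D + H + 1) * N\<^sup>2 \<and>
        proj_dist v (abs_proj (of_int_vec (X s t))) (abs_proj (of_int_vec y)) \<le> (D + H + 1) / N"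
      using X0 dist by blast
  qed
qed

text \<open>At the real place take an integer for \<open>s / t\<close>, at a prime \<open>p\<close> a power of \<open>1 / p\<close>.\<close>

lemma exists_large_ratio:
  obtains N s t where "N \<ge> M" "s \<noteq> 0" "t \<noteq> 0" "\<bar>real_of_int s\<bar> \<le> N" "\<bar>real_of_int t\<bar> \<le> N"
    "N * int_abs v t = int_abs v s"
proof (cases v)
  case Real_place
  define s where "s = max 1 \<lceil>M\<rceil>"
  have "s \<ge> 1" "real_of_int s \<ge> M" by (auto simp: s_def) linarith
  then show ?thesis using that[of "real_of_int s" s 1] by (simp add: Real_place)
next
  case (Padic_place p)
  let ?p = "Rep_prime_number p"
  have p: "prime ?p" using Rep_prime_number by blast
  then have p1: "real ?p > 1" using prime_gt_1_nat by simp
  then obtain k where k: "M < real ?p ^ k" using real_arch_pow by blast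
  have "multiplicity (int ?p) (int ?p ^ k) = k" using p by (intro multiplicity_same_power) auto
  moreover have "multiplicity (int ?p) 1 = 0" by simp
  ultimately have "int_abs v (int ?p ^ k) = (1 / real ?p) ^ k" "int_abs v 1 = 1"
    using p1 by (simp_all add: Padic_place int_abs_padic)
  then show ?thesis using k p1 that[of "real ?p ^ k" 1 "int ?p ^ k"]
    by (simp add: power_one_over)
qed

section \<open>The complement of the tangent hyperplane\<close>

lemma complex_point_of_int_vec:
  fixes x :: "int^'n::finite"
  assumes "x \<noteq> 0"
  shows "complex_point (abs_proj (of_int_vec x)) = abs_proj (of_int_vec x)"
proof -
  have "projrel (of_int_vec x :: rat^'n) (of_int_vec x)" using assms by (simp add: projrel_refl)
  moreover have "(\<chi> i. of_rat (of_int_vec x $ i)) = (of_int_vec x :: complex^'n)"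
    by (simp add: vec_eq_iff)
  ultimately show ?thesis by (simp add: complex_point.abs_eq)
qed

lemma abs_proj_in_zero_locus_iff:
  fixes x :: "complex^'n::finite"
  assumes "x \<noteq> 0" "\<And>c x. peval \<phi> f (c *s x) = c ^ k * peval \<phi> f x"
  shows "abs_proj x \<in> zero_locus \<phi> f \<longleftrightarrow> peval \<phi> f x = 0"
proof
  assume "peval \<phi> f x = 0"
  then show "abs_proj x \<in> zero_locus \<phi> f"
    using assms by (auto simp: zero_locus_def abs_proj_eq_iff)
qed (use assms(1) in \<open>auto simp: zero_locus_def\<close>)

definition tangent_hyperplane :: "int^'n^'n \<Rightarrow> int^'n \<Rightarrow> (complex, 'n::finite) proj set" where
  "tangent_hyperplane A y = {abs_proj x | x. x \<noteq> 0 \<and> polar A (of_int_vec y) x = 0}"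

lemma abs_proj_in_tangent_hyperplane_iff:
  assumes "x \<noteq> 0"
  shows "abs_proj x \<in> tangent_hyperplane A y \<longleftrightarrow> polar A (of_int_vec y) x = 0"
  using assms by (auto simp: tangent_hyperplane_def abs_proj_eq_iff polar_scale_right)

lemma openin_tangent_hyperplane_complement:
  fixes y :: "int^'n::finite"
  shows "openin zariski (- tangent_hyperplane A y)"
proof -
  define l :: "rat^'n" where "l = (\<chi> j. \<Sum>i\<in>UNIV. of_int (A $ i $ j + A $ j $ i) * of_int (y $ i))"
  obtain f :: "(rat, 'n) poly_ring" where f: "homogeneous 1 f"
    "\<And>x :: complex^'n. peval of_rat f x = (\<Sum>i\<in>UNIV. of_rat (l $ i) * x $ i)"
    by (rule linear_form_exists[of l]) blast
  have fx: "peval of_rat f x = polar A (of_int_vec y) x" for x :: "complex^'n"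
    unfolding f(2) polar_eq_matrix l_def by (simp add: of_rat_sum of_rat_mult of_rat_add)
  have "P \<in> tangent_hyperplane A y \<longleftrightarrow> P \<in> zero_locus of_rat f" for P
  proof -
    obtain x where x: "x \<noteq> 0" "P = abs_proj x" by (rule abs_proj_cases)
    have "abs_proj x \<in> zero_locus of_rat f \<longleftrightarrow> peval of_rat f x = 0"
      by (rule abs_proj_in_zero_locus_iff[where k = 1]) (simp_all add: x fx polar_scale_right)
    then show ?thesis by (simp add: x abs_proj_in_tangent_hyperplane_iff fx)
  qed
  then have "tangent_hyperplane A y = zero_locus of_rat f" by blast
  then show ?thesis
    unfolding zariski_def using f(1) by (intro topology_generated_by_Basis) blast
qed

text \<open>The approximation argument sees the form only through a matrix and the marked point only
  through integer coordinates \<open>y\<close>.\<close>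

locale pointed_quadric =
  fixes A :: "int^'n^'n::finite" and y :: "int^'n" and V :: "(complex, 'n) proj set"
  assumes card: "CARD('n) \<ge> 3"
    and nondegenerate: "\<And>x :: rat^'n. (\<And>z. polar A x z = 0) \<Longrightarrow> x = 0"
    and y: "y \<noteq> 0" "quad A y = 0"
    and in_V_iff: "\<And>x. x \<noteq> 0 \<Longrightarrow> abs_proj x \<in> V \<longleftrightarrow> quad A x = 0"
begin

abbreviation T :: "(complex, 'n) proj set" where "T \<equiv> tangent_hyperplane A y"
abbreviation Q0 :: "(rat, 'n) proj" where "Q0 \<equiv> abs_proj (of_int_vec y)"
abbreviation yc :: "complex^'n" where "yc \<equiv> of_int_vec y"

lemma quad_yc: "quad A yc = 0"
  by (simp add: quad_of_int_vec y)

lemma rational_points_iff: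
  assumes "x \<noteq> 0"
  shows "abs_proj (of_int_vec x) \<in> rational_points (V - T) \<longleftrightarrow> quad A x = 0 \<and> polar A y x \<noteq> 0"
  using assms by (simp add: rational_points_def complex_point_of_int_vec in_V_iff
      abs_proj_in_tangent_hyperplane_iff quad_of_int_vec polar_of_int_vec)

text \<open>Around a point \<open>p\<close> of the quadric, the second intersections with the lines through \<open>p\<close> form a
  family parametrised by the irreducible affine space; \<open>p\<close> itself belongs to it, as a value at an
  anisotropic tangent direction, and not all members lie in \<open>T\<close>.\<close>

lemma meets_complement_of_tangent_hyperplane:
  assumes U: "openin zariski U" and P: "P \<in> V" "P \<in> U"
  obtains Q where "Q \<in> V" "Q \<in> U" "Q \<notin> T"
proof -
  have ndc: "x = 0" if "\<And>z. polar A x z = 0" for x :: "complex^'n"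
    using nondegenerate_complex nondegenerate that by blast
  obtain p where p: "p \<noteq> 0" "P = abs_proj p" by (rule abs_proj_cases)
  have qp: "quad A p = 0" using P p in_V_iff by blast
  show ?thesis
  proof (cases "P \<in> T")
    case False
    then show ?thesis using P that by blast
  next
    case True
    then have yp: "polar A yc p = 0" using p by (simp add: abs_proj_in_tangent_hyperplane_iff)
    obtain w0 where w0: "polar A p w0 = 0" "quad A w0 \<noteq> 0"
      using exists_anisotropic_orthogonal[OF ndc card p(1) qp] by blast
    define x where "x = second_point A p w0"
    have x: "x = quad A w0 *s p" using w0 by (simp add: x_def second_point_def)
    have "x \<noteq> 0" using x w0 p by (simp add: vec_eq_iff)
    moreover have "abs_proj x = P" using x w0 p by (simp add: abs_proj_scale)
    ultimately obtain g where g: "polyfun g" "g x \<noteq> 0"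
      "\<And>z. z \<noteq> 0 \<Longrightarrow> g z \<noteq> 0 \<Longrightarrow> abs_proj z \<in> U"
      using zariski_open_polyfun[OF U] P by metis
    obtain a where a: "polar A p a \<noteq> 0" using ndc p(1) by blast
    obtain b where b: "polar A yc b \<noteq> 0" using ndc[of yc] y by auto
    obtain c where c: "polar A p c \<noteq> 0" "polar A yc c \<noteq> 0"
      using polyfun_mult_nonzero[OF polyfun_polar polyfun_polar a b] .
    have "polyfun (\<lambda>w. g (second_point A p w))"
      by (rule polyfun_compose[OF g(1) polyfun_second_point])
    moreover have "polyfun (\<lambda>w. polar A p w * polar A yc w)"
      by (intro polyfun_mult polyfun_polar)
    moreover have "g (second_point A p w0) \<noteq> 0" "polar A p c * polar A yc c \<noteq> 0"
      using g c by (simp_all add: x_def)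
    ultimately obtain w where w: "g (second_point A p w) \<noteq> 0" "polar A p w * polar A yc w \<noteq> 0"
      by (rule polyfun_mult_nonzero)
    have bw: "polar A yc (second_point A p w) = - (polar A p w * polar A yc w)"
      by (simp add: second_point_def polar_diff_right polar_scale_right yp)
    then have nz: "second_point A p w \<noteq> 0" using w(2) by (auto simp: polar_def)
    show ?thesis
    proof (rule that)
      show "abs_proj (second_point A p w) \<in> V" using nz in_V_iff quad_second_point[OF qp] by blast
      show "abs_proj (second_point A p w) \<in> U" using g(3) nz w(1) by blast
      show "abs_proj (second_point A p w) \<notin> T"
        using bw w(2) by (simp add: abs_proj_in_tangent_hyperplane_iff[OF nz])
    qed
  qed
qed

lemma complement_open_dense: "V - T \<in> open_dense_subvarieties V"
proof -
  have "openin (subtopology zariski V) (V - T)"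
    unfolding openin_subtopology using openin_tangent_hyperplane_complement[of A y] by blast
  moreover have "(subtopology zariski V) closure_of (V - T) = V"
  proof
    show "(subtopology zariski V) closure_of (V - T) \<subseteq> V"
      by (metis closure_of_subset_topspace topspace_subtopology topspace_zariski Int_UNIV_left)
    show "V \<subseteq> (subtopology zariski V) closure_of (V - T)"
    proof
      fix P assume P: "P \<in> V"
      show "P \<in> (subtopology zariski V) closure_of (V - T)"
        unfolding in_closure_of
      proof (intro conjI allI impI)
        show "P \<in> topspace (subtopology zariski V)" using P by (simp add: topspace_zariski)
        fix S assume "P \<in> S \<and> openin (subtopology zariski V) S"
        then obtain U where U: "openin zariski U" "S = U \<inter> V" "P \<in> U"
          unfolding openin_subtopology by blast
        obtain Q where "Q \<in> V" "Q \<in> U" "Q \<notin> T"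
          using meets_complement_of_tangent_hyperplane[OF U(1) P U(3)] .
        then show "\<exists>Q. Q \<in> V - T \<and> Q \<in> S" using U by blast
      qed
    qed
  qed
  ultimately show ?thesis by (simp add: open_dense_subvarieties_def)
qed

lemma distance_bound:
  obtains K where "K > 0" "\<And>P. P \<in> rational_points (V - T) \<Longrightarrow>
    1 \<le> K * height P * (proj_dist v P Q0)\<^sup>2"
proof -
  obtain K where K: "K > 0" "\<And>x. x \<noteq> 0 \<Longrightarrow> quad A x = 0 \<Longrightarrow> polar A y x \<noteq> 0 \<Longrightarrow>
      1 \<le> K * height (abs_proj (of_int_vec x)) * (proj_dist v (abs_proj (of_int_vec x)) Q0)\<^sup>2"
    using height_mult_dist_square_ge[OF y, of v] by blast
  show ?thesis
  proof (rule that[OF K(1)])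
    fix P assume P: "P \<in> rational_points (V - T)"
    obtain z where z: "Gcd (range (($) z)) = 1" "P = abs_proj (of_int_vec z)"
      by (rule primitive_coordinates)
    then show "1 \<le> K * height P * (proj_dist v P Q0)\<^sup>2"
      using K(2) P primitive_nonzero rational_points_iff by metis
  qed
qed

section \<open>The approximation constants\<close>

text \<open>Raising \<open>1 \<le> K H d\<^sup>2\<close> to the power \<open>\<gamma> / 2\<close> and using \<open>d\<^sup>\<gamma> H < 1\<close> bounds \<open>H\<^bsup>1 - \<gamma>/2\<^esup>\<close>;
  for \<open>\<gamma> < 2\<close> this leaves finitely many points.\<close>

lemma approx_const_complement_ge: "approx_const v Q0 (V - T) \<ge> 2"
proof -
  obtain K where K: "K > 0" "\<And>P. P \<in> rational_points (V - T) \<Longrightarrow>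
    1 \<le> K * height P * (proj_dist v P Q0)\<^sup>2" using distance_bound[of v] by blast
  have "2 \<le> \<gamma>"
    if "\<gamma> > 0" and inf: "infinite {P \<in> rational_points (V - T). proj_dist v P Q0 powr \<gamma> * height P < 1}" for \<gamma>
  proof (rule ccontr)
    assume "\<not> 2 \<le> \<gamma>"
    then have \<gamma>: "\<gamma> < 2" by simp
    define e where "e = 1 - \<gamma> / 2"
    have e: "e > 0" using \<gamma> by (simp add: e_def)
    have "height P \<le> (K powr (\<gamma> / 2)) powr (1 / e)"
      if P: "P \<in> rational_points (V - T)" "proj_dist v P Q0 powr \<gamma> * height P < 1" for P
    proof -
      let ?d = "proj_dist v P Q0" and ?h = "height P"
      have h: "?h > 0" by (rule height_pos)
      have bound: "1 \<le> K * ?h * ?d\<^sup>2" using K P by blast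
      then have d: "?d > 0" using proj_dist_nonneg[of v P Q0] by (cases "?d = 0") auto
      have "1 \<le> (K * ?h * ?d\<^sup>2) powr (\<gamma> / 2)" using bound \<open>\<gamma> > 0\<close> by (intro ge_one_powr_ge_zero) auto
      also have "\<dots> = K powr (\<gamma> / 2) * ?h powr (\<gamma> / 2) * ?d powr \<gamma>"
        using K h d by (simp add: powr_mult powr_powr flip: powr_numeral)
      finally have 1: "1 \<le> K powr (\<gamma> / 2) * ?h powr (\<gamma> / 2) * ?d powr \<gamma>" .
      have "?h powr e = ?h / ?h powr (\<gamma> / 2)" using h by (simp add: e_def powr_diff)
      also have "\<dots> \<le> K powr (\<gamma> / 2) * (?d powr \<gamma> * ?h)"
        using mult_right_mono[OF 1, of ?h] h by (simp add: field_simps)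
      also have "\<dots> \<le> K powr (\<gamma> / 2) * 1"
        using P by (intro mult_left_mono) auto
      finally have "(?h powr e) powr (1 / e) \<le> (K powr (\<gamma> / 2)) powr (1 / e)"
        using e by (intro powr_mono2) auto
      then show ?thesis using e h by (simp add: powr_powr)
    qed
    then have "{P \<in> rational_points (V - T). proj_dist v P Q0 powr \<gamma> * height P < 1} \<subseteq>
       {P. height P \<le> (K powr (\<gamma> / 2)) powr (1 / e)}" by blast
    then show False using inf finite_bounded_height finite_subset by blast
  qed
  then show ?thesis unfolding approx_const_def by (intro Inf_greatest) auto
qed

text \<open>Stereographic projection reaches every point \<open>p\<close> off \<open>T\<close>, as \<open>second_point A y p\<close> is a multiple
  of \<open>p\<close>. Hence the condition of landing in \<open>Y\<close> off \<open>T\<close> is a nonzero polynomial in \<open>w\<close>, and holds at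
  some integer vector \<open>w1\<close>. On the line through \<open>w1\<close> with direction \<open>w0\<close> it then fails for finitely
  many parameters \<open>r = s / t\<close> only, and these are avoided by taking \<open>r\<close> large at \<open>v\<close>.\<close>

lemma approximating_points:
  assumes Y: "Y \<in> open_dense_subvarieties V"
  obtains K where "K > 0" "\<And>M. \<exists>N P. N \<ge> M \<and> N > 0 \<and> P \<in> rational_points (Y - T) \<and>
     height P \<le> K * N\<^sup>2 \<and> proj_dist v P Q0 \<le> K / N"
proof -
  from Y obtain U where U: "openin zariski U" "Y = U \<inter> V" "(subtopology zariski V) closure_of Y = V"
    unfolding open_dense_subvarieties_def openin_subtopology by blast
  have "abs_proj yc \<in> V" using y quad_yc in_V_iff by simp
  then have "Y \<noteq> {}" using U(3) by force
  then obtain P where "P \<in> V" "P \<in> U" using U(2) by blast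
  from meets_complement_of_tangent_hyperplane[OF U(1) this]
  obtain Q where Q: "Q \<in> V" "Q \<in> U" "Q \<notin> T" .
  obtain p where p: "p \<noteq> 0" "Q = abs_proj p" by (rule abs_proj_cases)
  have bp: "polar A yc p \<noteq> 0" using Q p by (simp add: abs_proj_in_tangent_hyperplane_iff)
  have qp: "quad A p = 0" using Q p in_V_iff by blast
  have "second_point A yc p = (- polar A yc p) *s p"
    by (simp add: second_point_def qp vec_eq_iff)
  then have "second_point A yc p \<noteq> 0" "abs_proj (second_point A yc p) = Q"
    using p bp abs_proj_scale[of p "- polar A yc p"] by (simp_all only:) (auto simp: vec_eq_iff)
  then obtain g where g: "polyfun g" "g (second_point A yc p) \<noteq> 0"
      "\<And>z. z \<noteq> 0 \<Longrightarrow> g z \<noteq> 0 \<Longrightarrow> abs_proj z \<in> U"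
    using zariski_open_polyfun[OF U(1)] Q(2) by metis
  have gp: "polyfun (\<lambda>w. g (second_point A yc w))"
    by (rule polyfun_compose[OF g(1) polyfun_second_point])
  obtain w1 :: "int^'n" where "g (second_point A yc (of_int_vec w1)) * polar A yc (of_int_vec w1) \<noteq> 0"
    by (rule polyfun_integer_nonzero[OF polyfun_mult[OF gp polyfun_polar], of p]) (use g bp in auto)
  then have w1: "g (second_point A yc (of_int_vec w1)) \<noteq> 0" "polar A y w1 \<noteq> 0"
    by (auto simp: polar_of_int_vec)
  obtain w0' :: "rat^'n" where w0': "polar A (of_int_vec y) w0' = 0" "quad A w0' \<noteq> 0"
    using exists_anisotropic_orthogonal[of A "of_int_vec y", OF nondegenerate card] y
    by (auto simp: quad_of_int_vec)
  obtain d w0 where d: "d \<noteq> 0" "of_int d *s w0' = of_int_vec w0" by (rule clear_denominators)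
  have "(of_int (polar A y w0) :: rat) = of_int d * polar A (of_int_vec y) w0'"
    by (simp add: polar_of_int_vec[symmetric] d(2)[symmetric] polar_scale_right)
  then have bw0: "polar A y w0 = 0" using w0' by simp
  have "(of_int (quad A w0) :: rat) = (of_int d)\<^sup>2 * quad A w0'"
    by (simp add: quad_of_int_vec[symmetric] d(2)[symmetric] quad_scale)
  then have qw0: "quad A w0 \<noteq> 0" using w0' d by auto
  define X where "X s t = second_point A y (s *s w0 + t *s w1)" for s t
  obtain K N0 where K: "K > 0" "N0 > 0"
    "\<And>N s t. N \<ge> N0 \<Longrightarrow> s \<noteq> 0 \<Longrightarrow> \<bar>real_of_int s\<bar> \<le> N \<Longrightarrow> \<bar>real_of_int t\<bar> \<le> N \<Longrightarrow>
      N * int_abs v t \<le> int_abs v s \<Longrightarrow>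
      X s t \<noteq> 0 \<and> vnorm Real_place (X s t) \<le> K * N\<^sup>2 \<and>
      proj_dist v (abs_proj (of_int_vec (X s t))) Q0 \<le> K / N"
    using conic_approximation[OF y bw0 qw0, where ?w1.0 = w1 and v = v] unfolding X_def by blast
  \<comment> \<open>The parameters at which the conic may leave \<open>U\<close>.\<close>
  define B where "B = {r. g (second_point A yc (of_int_vec w1 + r *s of_int_vec w0)) = 0}"
  have "finite B"
    unfolding B_def by (rule polyfun_finite_zeros_on_line[OF gp, of _ 0]) (use w1 in simp)
  have "finite ((\<lambda>r. place_abs v r) ` (of_rat -` B))"
    by (intro finite_imageI finite_vimageI \<open>finite B\<close>) (auto simp: inj_on_def)
  then obtain b where b: "\<And>r. of_rat r \<in> B \<Longrightarrow> place_abs v r \<le> b"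
    by (metis bdd_above.unfold bdd_above_finite imageI vimageI)
  show ?thesis
  proof (rule that[OF K(1)])
    fix M
    obtain N s t where N: "N \<ge> max (max M N0) (b + 1)" and s: "s \<noteq> 0" and t: "t \<noteq> 0"
      and st: "\<bar>real_of_int s\<bar> \<le> N" "\<bar>real_of_int t\<bar> \<le> N" "N * int_abs v t = int_abs v s"
      by (rule exists_large_ratio)
    have X: "X s t \<noteq> 0" "vnorm Real_place (X s t) \<le> K * N\<^sup>2"
      "proj_dist v (abs_proj (of_int_vec (X s t))) Q0 \<le> K / N"
      using K(3)[of N s t] N s st by auto
    define r :: rat where "r = of_int s / of_int t"
    have "place_abs v r * int_abs v t = int_abs v s"
      unfolding int_abs_def r_def using t by (simp flip: place_abs_mult)
    then have "place_abs v r * int_abs v t = N * int_abs v t" using st by simp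
    then have "place_abs v r = N" using t by simp
    then have "of_rat r \<notin> B" using b[of r] N by auto
    define w :: "complex^'n" where "w = of_int_vec w1 + of_rat r *s of_int_vec w0"
    have gw: "g (second_point A yc w) \<noteq> 0" using \<open>of_rat r \<notin> B\<close> by (simp add: B_def w_def)
    have sw: "of_int_vec (s *s w0 + t *s w1) = of_int t *s w"
      using t by (simp add: w_def r_def vec_eq_iff of_rat_divide field_simps)
    have Xw: "(of_int_vec (X s t) :: complex^'n) = (of_int t)\<^sup>2 *s second_point A yc w"
      by (simp add: X_def second_point_of_int_vec[symmetric] sw second_point_scale)
    then have w0: "second_point A yc w \<noteq> 0"
      using X(1) by (metis of_int_vec_eq_0_iff vector_smult_rzero)
    let ?P = "abs_proj (of_int_vec (X s t)) :: (rat, 'n) proj"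
    have cP: "complex_point ?P = abs_proj (second_point A yc w)"
      using X(1) t w0 by (simp add: complex_point_of_int_vec Xw abs_proj_scale)
    have "polar A y (X s t) = - (t * polar A y w1)\<^sup>2"
      by (simp add: X_def polar_second_point[OF y(2)] polar_add_right polar_scale_right bw0)
    then have "?P \<in> rational_points (V - T)"
      using t w1(2) by (simp add: rational_points_iff[OF X(1)])
        (simp add: X_def quad_second_point[OF y(2)])
    moreover have "complex_point ?P \<in> U" unfolding cP by (rule g(3)[OF w0 gw])
    ultimately have "?P \<in> rational_points (Y - T)" by (simp add: rational_points_def U(2))
    moreover have "height ?P \<le> K * N\<^sup>2" using height_le_vnorm[OF X(1)] X(2) by linarith
    ultimately show "\<exists>N P. N \<ge> M \<and> N > 0 \<and> P \<in> rational_points (Y - T) \<and>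
     height P \<le> K * N\<^sup>2 \<and> proj_dist v P Q0 \<le> K / N"
      using N X(3) K(2) by (intro exI[of _ N] exI[of _ ?P]) auto
  qed
qed

text \<open>The approximating points are distinct from \<open>Q\<^sub>0\<close> but come arbitrarily close to it, so
  finitely many of them cannot suffice.\<close>

lemma approx_const_le:
  assumes Y: "Y \<in> open_dense_subvarieties V"
  shows "approx_const v Q0 Y \<le> 2"
proof -
  obtain K where K: "K > 0" "\<And>M. \<exists>N P. N \<ge> M \<and> N > 0 \<and> P \<in> rational_points (Y - T) \<and>
     height P \<le> K * N\<^sup>2 \<and> proj_dist v P Q0 \<le> K / N"
    using approximating_points[OF Y, of v] by blast
  obtain C where C: "C > 0" "\<And>P. P \<in> rational_points (V - T) \<Longrightarrow>
    1 \<le> C * height P * (proj_dist v P Q0)\<^sup>2" using distance_bound[of v] by blast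
  have YV: "Y \<subseteq> V" using Y by (auto simp: open_dense_subvarieties_def openin_subtopology)
  have dpos: "proj_dist v P Q0 > 0" if "P \<in> rational_points (Y - T)" for P
  proof -
    have "P \<in> rational_points (V - T)" using that YV by (auto simp: rational_points_def)
    then have "1 \<le> C * height P * (proj_dist v P Q0)\<^sup>2" by (rule C(2))
    then show ?thesis using proj_dist_nonneg[of v P Q0] by (cases "proj_dist v P Q0 = 0") auto
  qed
  have inf: "infinite {P \<in> rational_points Y. proj_dist v P Q0 powr \<gamma> * height P < 1}"
    if \<gamma>: "\<gamma> > 2" for \<gamma>
  proof
    let ?S = "{P \<in> rational_points Y. proj_dist v P Q0 powr \<gamma> * height P < 1}"
    assume "finite ?S"
    define \<delta> where "\<delta> = Min (insert 1 ((\<lambda>P. proj_dist v P Q0) ` (?S \<inter> rational_points (Y - T))))"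
    have fin: "finite (insert 1 ((\<lambda>P. proj_dist v P Q0) ` (?S \<inter> rational_points (Y - T))))"
      using \<open>finite ?S\<close> by simp
    have \<delta>: "\<delta> > 0" unfolding \<delta>_def using fin dpos by (subst Min_gr_iff) auto
    have \<delta>_le: "\<delta> \<le> proj_dist v P Q0" if "P \<in> ?S" "P \<in> rational_points (Y - T)" for P
      unfolding \<delta>_def using fin that by (intro Min_le) auto
    have "((\<lambda>N. K powr \<gamma> * K * N powr (2 - \<gamma>)) \<longlongrightarrow> K powr \<gamma> * K * 0) at_top"
      using \<gamma> by (intro tendsto_mult tendsto_const tendsto_neg_powr filterlim_ident) auto
    then have "eventually (\<lambda>N. K powr \<gamma> * K * N powr (2 - \<gamma>) < 1) at_top"
      by (rule order_tendstoD) simp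
    then obtain M where M: "\<And>N. N \<ge> M \<Longrightarrow> K powr \<gamma> * K * N powr (2 - \<gamma>) < 1"
      unfolding eventually_at_top_linorder by blast
    obtain N P where N: "N \<ge> max M (K / \<delta> + 1)" "N > 0" and P: "P \<in> rational_points (Y - T)"
      "height P \<le> K * N\<^sup>2" "proj_dist v P Q0 \<le> K / N" using K(2) by blast
    have "proj_dist v P Q0 powr \<gamma> * height P \<le> (K / N) powr \<gamma> * (K * N\<^sup>2)"
      using P \<gamma> K N dpos[OF P(1)] height_pos[of P] by (intro mult_mono powr_mono2) auto
    also have "\<dots> = K powr \<gamma> * K * N powr (2 - \<gamma>)"
      using K N by (simp add: powr_divide powr_diff)
    also have "\<dots> < 1" using M N by simp
    finally have "P \<in> ?S" using P(1) by (auto simp: rational_points_def)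
    then have "\<delta> \<le> K / N" using \<delta>_le P by force
    then have "N \<le> K / \<delta>" using N \<delta> by (simp add: field_simps)
    then show False using N by simp
  qed
  have "approx_const v Q0 Y \<le> ereal \<gamma>" if "\<gamma> > 2" for \<gamma>
    unfolding approx_const_def using that inf[OF that] by (intro Inf_lower imageI) auto
  then have "approx_const v Q0 Y \<le> ereal 2 + ereal e" if "e > 0" for e
    using that by simp
  then have "approx_const v Q0 Y \<le> ereal 2" by (rule ereal_le_epsilon2[rule_format])
  then show ?thesis by simp
qed

lemma ess_const_eq_2: "ess_const v Q0 V = 2"
  unfolding ess_const_def
proof (rule antisym)
  show "(SUP Y\<in>open_dense_subvarieties V. approx_const v Q0 Y) \<le> 2"
    by (intro SUP_least approx_const_le)
  show "2 \<le> (SUP Y\<in>open_dense_subvarieties V. approx_const v Q0 Y)"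
    using complement_open_dense approx_const_complement_ge by (rule SUP_upper2)
qed

end

theorem propositionA4:
  fixes n :: nat and F :: "(int, 'n::finite) poly_ring" and v :: place and Q0 :: "(rat, 'n) proj"
  assumes "CARD('n) = n + 1" and "n \<ge> 2"
    and "quadratic_form F" and "nondegenerate F"
    and "rational_points (quadric F) \<noteq> {}"
    and "Q0 \<in> rational_points (quadric F)"
  shows "ess_const v Q0 (quadric F) = 2"
proof -
  obtain A :: "int^'n^'n" where A: "\<And>x :: rat^'n. peval of_int F x = quad A x"
    "\<And>x :: complex^'n. peval of_int F x = quad A x"
    using quadratic_form_matrix[OF \<open>quadratic_form F\<close>] by blast
  obtain y where Q0: "Gcd (range (($) y)) = 1" "Q0 = abs_proj (of_int_vec y)"
    by (rule primitive_coordinates)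
  have y0: "y \<noteq> 0" using Q0(1) by (rule primitive_nonzero)
  have V: "abs_proj x \<in> quadric F \<longleftrightarrow> quad A x = 0" if "x \<noteq> 0" for x :: "complex^'n"
    using abs_proj_in_zero_locus_iff[OF that, of of_int F 2] by (simp add: A quad_scale)
  interpret pointed_quadric A y "quadric F"
  proof
    show "CARD('n) \<ge> 3" using assms by simp
    show "x = 0" if "\<And>z. polar A x z = 0" for x :: "rat^'n"
    proof -
      have "polar_form F x z = 0" for z
        using that[of z] by (simp add: polar_form_def A quad_add)
      then show ?thesis using \<open>nondegenerate F\<close> unfolding nondegenerate_def by blast
    qed
    show "y \<noteq> 0" by (rule y0)
    have "abs_proj (of_int_vec y) \<in> quadric F"
      using assms(6) y0 by (simp add: rational_points_def Q0(2) complex_point_of_int_vec)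
    then show "quad A y = 0" using V[of "of_int_vec y"] y0 by (simp add: quad_of_int_vec)
    show "abs_proj x \<in> quadric F \<longleftrightarrow> quad A x = 0" if "x \<noteq> 0" for x :: "complex^'n"
      using that by (rule V)
  qed
  show ?thesis unfolding Q0(2) by (rule ess_const_eq_2)
qed

end
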